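(* Let $d\ge 4$ and let $K_d$ be a complete metric graph on $d$ vertices. It is possible to omit $d-1$ edges from $K_d$, not containing a $K_3$ configuration, so that the resulting metric graph $K_d'$ is connected and has gonality $d-3$.
   Context: A metric graph $\Gamma$ is a compact connected topological space in which every point $p$ has a neighbourhood homeomorphic to a star with $\mathrm{val}(p)$ branches (with $\mathrm{val}(p)\neq 2$ for only finitely many $p$), equipped with a complete inner metric. The complete metric graph $K_d$ on $d$ vertices is the metric realization of the complete graph on $d$ vertices, where the edges have arbitrary (positive, finite) lengths. Omitting an edge means removing its interior; all $d$ vertices are kept. A set of edges contains a $K_3$ configuration if there are three vertices of $K_d$ such that all three edges between them belong to the set. A divisor on $\Gamma$ is an element $D=\sum_{p} a_p(p)$ of the free abelian group on the points of $\Gamma$; its degree is $\sum_p a_p$; it is effective ($D\geq 0$) if all $a_p\ge 0$. A rational function on $\Gamma$ is a continuous piecewise linear function $f:\Gamma\to\mathbb{R}$ with integer slopes and finitely many pieces; $\mathrm{div}(f)$ is the divisor whose coefficient at $p$ is the sum of the outgoing slopes of $f$ at $p$. Divisors $D_1,D_2$ are linearly equivalent, $D_1\sim D_2$, if $D_1-D_2=\mathrm{div}(f)$ for some rational function $f$, and $|D|=\{E\ge 0: E\sim D\}$. The rank $\mathrm{rk}_\Gamma(D)$ is $-1$ if $|D|=\emptyset$, and otherwise the maximal integer $r\ge 0$ such that $|D-E|\ne\emptyset$ for all effective divisors $E$ of degree $r$. The gonality $\mathrm{gon}(\Gamma)$ is the smallest integer $n$ for which there is a divisor on $\Gamma$ of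 degree $n$ and rank $1$. *)

theory Defs
  imports "HOL-Analysis.Analysis" "HOL-Library.Poly_Mapping"
begin

text \<open>
  A metric graph is presented by a simple graph together with a length for every edge; edges are
  two-element sets of vertices, so no orientation is chosen.
\<close>

record 'v metric_graph =
  verts :: "'v set"
  edges :: "'v set set"
  len :: "'v set \<Rightarrow> real"

definition complete_metric_graph :: "nat \<Rightarrow> 'v metric_graph \<Rightarrow> bool" where
  "complete_metric_graph d G \<longleftrightarrow>
     finite (verts G) \<and> card (verts G) = d \<and>
     edges G = {e. e \<subseteq> verts G \<and> card e = 2} \<and>
     (\<forall>e\<in>edges G. 0 < len G e)"

text \<open>
  The space is the geometric realization inside \<^typ>\<open>'v \<Rightarrow> real\<close>: the vertex \<open>v\<close> is
  the unit vector at \<open>v\<close> and an edge is the segment joining its two ends, with the subspace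
  topology. The metric is the inner one for which \<open>edge_point G u v\<close> parametrizes the edge by arc
  length, starting at \<open>u\<close>; it is not the one induced by the embedding. It enters below only through
  these parametrizations, with respect to which slopes are taken.
\<close>

type_synonym 'v point = "'v \<Rightarrow> real"

definition vertex_point :: "'v \<Rightarrow> 'v point" where
  "vertex_point v = indicator {v}"

definition edge_point :: "'v metric_graph \<Rightarrow> 'v \<Rightarrow> 'v \<Rightarrow> real \<Rightarrow> 'v point" where
  "edge_point G u v t = (\<lambda>w. (1 - t / len G {u, v}) * vertex_point u w
                             + (t / len G {u, v}) * vertex_point v w)"

definition points :: "'v metric_graph \<Rightarrow> 'v point set" where
  "points G = vertex_point ` verts G
     \<union> {edge_point G u v t | u v t. {u, v} \<in> edges G \<and> 0 \<le> t \<and> t \<le> len G {u, v}}"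

definition edge_interior :: "'v metric_graph \<Rightarrow> 'v set \<Rightarrow> 'v point set" where
  "edge_interior G e = {edge_point G u v t | u v t. {u, v} = e \<and> 0 < t \<and> t < len G e}"

definition omit_edges :: "'v metric_graph \<Rightarrow> 'v set set \<Rightarrow> 'v metric_graph" where
  "omit_edges G S = G\<lparr>edges := edges G - S\<rparr>"

text \<open>Omitting edges removes exactly their interiors from the space; all vertices are kept.\<close>

lemma support_edge_interior:
  assumes "x \<in> edge_interior G e" "card e = 2"
  shows "{w. x w \<noteq> 0} = e"
proof -
  obtain u v t where uv: "x = edge_point G u v t" "{u, v} = e" "0 < t" "t < len G e"
    using assms(1) unfolding edge_interior_def by blast
  have "u \<noteq> v" using uv(2) assms(2) by auto
  then show ?thesis
    using uv by (auto simp: edge_point_def vertex_point_def indicator_def divide_simps)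
qed

lemma support_vertex_point: "{w. vertex_point v w \<noteq> 0} = {v}"
  by (auto simp: vertex_point_def indicator_def)

lemma edge_point_cases:
  assumes "0 \<le> t" "t \<le> len G {u, v}" "0 < len G {u, v}"
  shows "edge_point G u v t = vertex_point u \<or> edge_point G u v t = vertex_point v \<or>
         edge_point G u v t \<in> edge_interior G {u, v}"
proof -
  consider "t = 0" | "t = len G {u, v}" | "0 < t" "t < len G {u, v}"
    using assms by linarith
  then show ?thesis
  proof cases
    case 1
    then show ?thesis by (simp add: edge_point_def)
  next
    case 2
    then show ?thesis using assms(3) by (simp add: edge_point_def)
  next
    case 3
    then show ?thesis unfolding edge_interior_def by blast
  qed
qed

lemma points_omit_edges:
  assumes K: "complete_metric_graph d G" and S: "S \<subseteq> edges G"
  shows "points (omit_edges G S) = points G - (\<Union>e\<in>S. edge_interior G e)"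
proof -
  have e2: "card e = 2" "e \<subseteq> verts G" "0 < len G e" if "e \<in> edges G" for e
    using K that unfolding complete_metric_graph_def by auto
  have ep: "edge_point (omit_edges G S) = edge_point G"
    by (simp add: edge_point_def omit_edges_def fun_eq_iff)
  have P: "points (omit_edges G S) = vertex_point ` verts G
     \<union> {edge_point G u v t | u v t. {u, v} \<in> edges G - S \<and> 0 \<le> t \<and> t \<le> len G {u, v}}"
    unfolding points_def ep by (simp add: omit_edges_def)
  have vertex: "vertex_point v \<notin> edge_interior G e" if "e \<in> S" for v e
  proof
    assume "vertex_point v \<in> edge_interior G e"
    then have "{v} = e"
      using support_edge_interior e2(1) S that support_vertex_point by (metis subsetD)
    then show False using e2(1)[of e] S that by auto
  qed
  have other: "x \<notin> edge_interior G e" if "e \<in> S" "x \<in> edge_interior G e'" "e' \<in> edges G - S" for x e e'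
    using support_edge_interior e2(1) S that by (metis DiffE subsetD)
  show ?thesis
  proof (intro set_eqI iffI)
    fix x assume x: "x \<in> points (omit_edges G S)"
    then have "x \<in> points G" unfolding P unfolding points_def by blast
    moreover have "x \<notin> edge_interior G e" if "e \<in> S" for e
      using x unfolding P
    proof
      assume "x \<in> vertex_point ` verts G"
      then show ?thesis using vertex that by blast
    next
      assume "x \<in> {edge_point G u v t | u v t.
                  {u, v} \<in> edges G - S \<and> 0 \<le> t \<and> t \<le> len G {u, v}}"
      then obtain u v t where "x = edge_point G u v t" "{u, v} \<in> edges G - S"
          "0 \<le> t" "t \<le> len G {u, v}" by blast
      then show ?thesis
        using edge_point_cases[of t G u v] e2(3) vertex[OF that] other[OF that] by (metis DiffD1)
    qed
    ultimately show "x \<in> points G - (\<Union>e\<in>S. edge_interior G e)" by blast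
  next
    fix x assume x: "x \<in> points G - (\<Union>e\<in>S. edge_interior G e)"
    show "x \<in> points (omit_edges G S)"
    proof (cases "x \<in> vertex_point ` verts G")
      case True
      then show ?thesis unfolding P by blast
    next
      case False
      then obtain u v t where uvt: "x = edge_point G u v t" "{u, v} \<in> edges G"
          "0 \<le> t" "t \<le> len G {u, v}"
        using x unfolding points_def by blast
      then have "u \<in> verts G" "v \<in> verts G" using e2(2) by auto
      then have "x \<in> edge_interior G {u, v}"
        using False uvt edge_point_cases[of t G u v] e2(3) by blast
      then have "{u, v} \<notin> S" using x by blast
      then show ?thesis using uvt unfolding P by blast
    qed
  qed
qed

definition contains_K3 :: "'v metric_graph \<Rightarrow> 'v set set \<Rightarrow> bool" where
  "contains_K3 G S \<longleftrightarrow>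
     (\<exists>u\<in>verts G. \<exists>v\<in>verts G. \<exists>w\<in>verts G. u \<noteq> v \<and> v \<noteq> w \<and> u \<noteq> w \<and>
        {u, v} \<in> S \<and> {v, w} \<in> S \<and> {u, w} \<in> S)"

text \<open>Divisors are elements of the free abelian group \<^typ>\<open>'v point \<Rightarrow>\<^sub>0 int\<close> supported on \<open>G\<close>.\<close>

type_synonym 'v divisor = "'v point \<Rightarrow>\<^sub>0 int"

definition divisors :: "'v metric_graph \<Rightarrow> 'v divisor set" where
  "divisors G = {D. Poly_Mapping.keys D \<subseteq> points G}"

definition divisor_degree :: "'v divisor \<Rightarrow> int" where
  "divisor_degree D = (\<Sum>p\<in>Poly_Mapping.keys D. Poly_Mapping.lookup D p)"

definition effective_divisor :: "'v divisor \<Rightarrow> bool" where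
  "effective_divisor D \<longleftrightarrow> (\<forall>p. 0 \<le> Poly_Mapping.lookup D p)"

text \<open>In the next definition \<open>B\<close> is the finite set of parameters at which the slope may change.\<close>

definition rational_function :: "'v metric_graph \<Rightarrow> ('v point \<Rightarrow> real) \<Rightarrow> bool" where
  "rational_function G f \<longleftrightarrow>
     continuous_on (points G) f \<and>
     (\<forall>u v. {u, v} \<in> edges G \<longrightarrow>
        (\<exists>B. finite B \<and>
           (\<forall>a b. 0 \<le> a \<and> a < b \<and> b \<le> len G {u, v} \<and> {a<..<b} \<inter> B = {} \<longrightarrow>
              (\<exists>(m::int) (c::real). \<forall>t\<in>{a<..<b}. f (edge_point G u v t) = of_int m * t + c))))"

text \<open>
  The triple \<open>(u, v, t)\<close> is the direction towards \<open>v\<close> at the point \<open>edge_point G u v t\<close>. A point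
  inside an edge has two of these, one for each order of the two ends; a vertex has one for every
  incident edge, with \<open>t = 0\<close>.
\<close>

definition directions :: "'v metric_graph \<Rightarrow> 'v point \<Rightarrow> ('v \<times> 'v \<times> real) set" where
  "directions G p =
     {(u, v, t). {u, v} \<in> edges G \<and> 0 \<le> t \<and> t < len G {u, v} \<and> edge_point G u v t = p}"

definition outgoing_slope ::
    "'v metric_graph \<Rightarrow> ('v point \<Rightarrow> real) \<Rightarrow> 'v \<times> 'v \<times> real \<Rightarrow> real" where
  "outgoing_slope G f = (\<lambda>(u, v, t). vector_derivative (\<lambda>s. f (edge_point G u v s)) (at_right t))"

definition div_coeff :: "'v metric_graph \<Rightarrow> ('v point \<Rightarrow> real) \<Rightarrow> 'v point \<Rightarrow> real" where
  "div_coeff G f p = (\<Sum>\<tau>\<in>directions G p. outgoing_slope G f \<tau>)"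

definition is_div_of :: "'v metric_graph \<Rightarrow> 'v divisor \<Rightarrow> ('v point \<Rightarrow> real) \<Rightarrow> bool" where
  "is_div_of G D f \<longleftrightarrow>
     D \<in> divisors G \<and> (\<forall>p\<in>points G. of_int (Poly_Mapping.lookup D p) = div_coeff G f p)"

definition linearly_equivalent :: "'v metric_graph \<Rightarrow> 'v divisor \<Rightarrow> 'v divisor \<Rightarrow> bool" where
  "linearly_equivalent G D1 D2 \<longleftrightarrow> (\<exists>f. rational_function G f \<and> is_div_of G (D1 - D2) f)"

definition linear_system :: "'v metric_graph \<Rightarrow> 'v divisor \<Rightarrow> 'v divisor set" where
  "linear_system G D = {E \<in> divisors G. effective_divisor E \<and> linearly_equivalent G E D}"

definition divisor_rank :: "'v metric_graph \<Rightarrow> 'v divisor \<Rightarrow> int" where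
  "divisor_rank G D =
     (if linear_system G D = {} then - 1
      else int (GREATEST r::nat. \<forall>E\<in>divisors G. effective_divisor E \<and> divisor_degree E = int r
                                   \<longrightarrow> linear_system G (D - E) \<noteq> {}))"

definition gonality :: "'v metric_graph \<Rightarrow> int" where
  "gonality G = (LEAST n::int. \<exists>D\<in>divisors G. divisor_degree D = n \<and> divisor_rank G D = 1)"

end

theory Submission
  imports Defs
begin

text \<open>
  Choose vertices \<open>w\<close>, \<open>b\<close>, \<open>v\<close> of \<open>K\<close> and let \<open>R\<close> be the set of the other \<open>d - 3\<close> vertices. The omitted edges
  are all the edges at \<open>v\<close> except \<open>vw\<close>, together with \<open>wb\<close>; a triangle among them would have to contain \<open>v\<close>
  and both \<open>w\<close> and \<open>b\<close>, but \<open>vw\<close> is kept. In the graph that remains, \<open>R \<union> {w}\<close> and \<open>R \<union> {b}\<close> are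
  cliques, and \<open>v\<close> is a leaf attached to \<open>w\<close>. Its gonality is \<open>d - 3\<close> whatever the edge lengths are.

  \<^bold>\<open>Upper bound.\<close> The divisor \<open>D\<close> with one chip on every vertex of \<open>R\<close> has degree \<open>d - 3\<close> and can be moved
  to any point. The two chips at the ends of an edge inside \<open>R\<close> can approach each other. All chips can
  move simultaneously towards \<open>b\<close>, since the edges from \<open>R\<close> to \<open>b\<close> form a cut; when the shortest of these
  edges is used up there is a chip at \<open>b\<close>, and on each of the longer ones this chip and the chip on its
  way can approach each other. The same works for \<open>w\<close>, and a chip at \<open>w\<close> can move along the leaf edge.
  All these moves are instances of \<open>principal_chip_moves\<close>: chips moving along edges change the divisor by
  a principal one as soon as the distances covered are the differences of a potential on the vertices.

  \<^bold>\<open>Lower bound.\<close> Let \<open>M\<close> be a clique with \<open>m\<close> vertices and \<open>D\<close> a divisor of degree less than \<open>m - 1\<close>. If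
  \<open>E\<close> and \<open>E' = E + div f\<close> are effective and of this degree, then \<open>f\<close> is constant on \<open>M\<close>
  (\<open>constant_on_clique\<close>): otherwise let \<open>A\<close> be the set of the \<open>j\<close> vertices of \<open>M\<close> at which \<open>f\<close> is maximal, with
  value \<open>c\<close>. The divisor \<open>E1 = E + div (max f c)\<close> is again effective, and passing from it to \<open>E'\<close> fires chips
  down the \<open>j * (m - j) \<ge> m - 1\<close> edges from \<open>A\<close> to the rest of \<open>M\<close>, more chips than \<open>E1\<close> has.
  Now suppose that \<open>D\<close> has rank at least one, and let \<open>E\<close> be an effective divisor equivalent to \<open>D\<close> whose
  support contains as many vertices of \<open>M\<close> as possible. Some \<open>v \<in> M\<close> is missed by \<open>E\<close> but contained in the
  support of some equivalent effective \<open>E' = E + div f\<close>. As \<open>f\<close> has a constant value \<open>c\<close> on \<open>M\<close>, the slopes of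
  \<open>max f c\<close> at the vertices of \<open>M\<close> are nonnegative, so that \<open>E + div (max f c)\<close> still contains all vertices
  of \<open>M\<close> that \<open>E\<close> does, and also \<open>v\<close>, contradicting the choice of \<open>E\<close> (\<open>clique_rank_bound\<close>). Applied to
  \<open>M = R \<union> {w}\<close> this excludes rank one below degree \<open>d - 3\<close>; it also shows that the divisor above does
  not have rank two, since subtracting a chip would leave a divisor of rank one and too small degree.

  Throughout, rational functions are handled through a local criterion (\<open>rational_iff_pl\<close>): a function is
  rational if and only if in every direction it is affine with integer slope on a short segment.
\<close>

section \<open>Geometry of the realization\<close>

text \<open>
  A finite metric graph without loops, multiple edges and isolated vertices. Every point of such a
  graph lies on an edge, and it suffices to look at functions edge by edge.
\<close>

locale finite_metric_graph =
  fixes G :: "'v metric_graph"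
  assumes finite_verts: "finite (verts G)"
    and card_edge: "e \<in> edges G \<Longrightarrow> card e = 2"
    and len_pos: "e \<in> edges G \<Longrightarrow> 0 < len G e"
    and Union_edges: "\<Union> (edges G) = verts G"
begin

abbreviation adj :: "'v \<Rightarrow> 'v \<Rightarrow> bool" where
  "adj u v \<equiv> {u, v} \<in> edges G"

abbreviation elen :: "'v \<Rightarrow> 'v \<Rightarrow> real" where
  "elen u v \<equiv> len G {u, v}"

abbreviation ep :: "'v \<Rightarrow> 'v \<Rightarrow> real \<Rightarrow> 'v point" where
  "ep \<equiv> edge_point G"

lemma adj_sym: "adj u v \<Longrightarrow> adj v u"
  by (simp add: insert_commute)

lemma elen_sym: "elen u v = elen v u"
  by (simp add: insert_commute)

lemma adj_neq: "adj u v \<Longrightarrow> u \<noteq> v"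
  using card_edge by fastforce

lemma adj_verts: "adj u v \<Longrightarrow> u \<in> verts G \<and> v \<in> verts G"
  using Union_edges by blast

lemma elen_pos: "adj u v \<Longrightarrow> 0 < elen u v"
  by (rule len_pos)

text \<open>The edges with both of their orientations.\<close>

definition arcs :: "('v \<times> 'v) set" where
  "arcs = {(u, v). adj u v}"

lemma finite_arcs: "finite arcs"
  by (rule finite_subset[of _ "verts G \<times> verts G"]) (auto simp: arcs_def finite_verts dest: adj_verts)

lemma verts_adj: "u \<in> verts G \<Longrightarrow> \<exists>v. adj u v"
proof -
  assume "u \<in> verts G"
  then obtain e where e: "e \<in> edges G" "u \<in> e" using Union_edges by blast
  then have "card e = 2" using card_edge by blast
  then obtain x y where "e = {x, y}" by (auto simp: card_2_iff)
  with e show ?thesis by (auto simp: insert_commute)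
qed

lemma ep_0: "ep u v 0 = vertex_point u"
  by (auto simp: edge_point_def)

lemma ep_elen: "adj u v \<Longrightarrow> ep u v (elen u v) = vertex_point v"
  using elen_pos[of u v] by (auto simp: edge_point_def)

lemma ep_swap: "adj u v \<Longrightarrow> ep v u t = ep u v (elen u v - t)"
  using elen_pos[of u v] by (auto simp: edge_point_def elen_sym[of v u] fun_eq_iff field_simps)

lemma ep_fst: "adj u v \<Longrightarrow> ep u v t u = 1 - t / elen u v"
  using adj_neq[of u v] by (auto simp: edge_point_def vertex_point_def)

lemma ep_snd: "adj u v \<Longrightarrow> ep u v t v = t / elen u v"
  using adj_neq[of u v] by (auto simp: edge_point_def vertex_point_def)

lemma ep_other: "w \<noteq> u \<Longrightarrow> w \<noteq> v \<Longrightarrow> ep u v t w = 0"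
  by (auto simp: edge_point_def vertex_point_def)

lemma ep_inj: "adj u v \<Longrightarrow> ep u v s = ep u v t \<longleftrightarrow> s = t"
  using elen_pos[of u v] ep_snd[of u v s] ep_snd[of u v t] by (metis divide_cancel_right less_irrefl)

lemma vertex_point_inj: "vertex_point u = vertex_point v \<longleftrightarrow> u = v"
  by (metis support_vertex_point singleton_inject)

lemma support_ep:
  assumes "adj u v" "0 < t" "t < elen u v"
  shows "{w. ep u v t w \<noteq> 0} = {u, v}"
proof (rule support_edge_interior)
  show "ep u v t \<in> edge_interior G {u, v}"
    unfolding edge_interior_def using assms(2,3) by (intro CollectI exI[of _ u] exI[of _ v] exI[of _ t]) simp
  show "card {u, v} = 2" by (rule card_edge[OF assms(1)])
qed

lemma ep_eq_vertex:
  assumes "adj u v" "0 \<le> t" "t \<le> elen u v"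
  shows "ep u v t = vertex_point w \<longleftrightarrow> (t = 0 \<and> w = u) \<or> (t = elen u v \<and> w = v)"
proof
  assume eq: "ep u v t = vertex_point w"
  have "\<not> (0 < t \<and> t < elen u v)"
  proof
    assume "0 < t \<and> t < elen u v"
    then have "{u, v} = {w}"
      using support_ep[of u v t] assms(1) eq support_vertex_point[of w] by simp
    then show False using adj_neq[OF assms(1)] by auto
  qed
  then consider "t = 0" | "t = elen u v" using assms by linarith
  then show "(t = 0 \<and> w = u) \<or> (t = elen u v \<and> w = v)"
  proof cases
    case 1
    then show ?thesis using eq by (simp add: ep_0 vertex_point_inj)
  next
    case 2
    then show ?thesis using eq ep_elen[OF assms(1)] by (simp add: vertex_point_inj)
  qed
qed (use assms in \<open>auto simp: ep_0 ep_elen\<close>)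

lemma ep_eq_interior:
  assumes "adj u v" "0 < t" "t < elen u v" "adj x y" "0 \<le> s" "s \<le> elen x y"
  shows "ep x y s = ep u v t \<longleftrightarrow> (x = u \<and> y = v \<and> s = t) \<or> (x = v \<and> y = u \<and> s = elen u v - t)"
proof
  assume eq: "ep x y s = ep u v t"
  have "s \<noteq> 0" using eq ep_eq_vertex[of u v t x] assms by (auto simp: ep_0)
  moreover have "s \<noteq> elen x y" using eq ep_eq_vertex[of u v t y] assms by (auto simp: ep_elen)
  ultimately have "0 < s" "s < elen x y" using assms by auto
  then have "{x, y} = {u, v}" using support_ep[of x y s] support_ep[of u v t] assms eq by simp
  then consider "x = u" "y = v" | "x = v" "y = u" by (auto simp: doubleton_eq_iff)
  then show "(x = u \<and> y = v \<and> s = t) \<or> (x = v \<and> y = u \<and> s = elen u v - t)"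
  proof cases
    case 1
    then show ?thesis using eq ep_inj assms by auto
  next
    case 2
    then have "ep u v (elen u v - s) = ep u v t" using eq ep_swap[of u v s] assms by auto
    then have "elen u v - s = t" using ep_inj assms by blast
    then show ?thesis using 2 by auto
  qed
next
  assume "(x = u \<and> y = v \<and> s = t) \<or> (x = v \<and> y = u \<and> s = elen u v - t)"
  then show "ep x y s = ep u v t" using ep_swap[OF assms(1), of "elen u v - t"] by auto
qed

lemma ep_points: "adj u v \<Longrightarrow> 0 \<le> t \<Longrightarrow> t \<le> elen u v \<Longrightarrow> ep u v t \<in> points G"
  unfolding points_def by blast

lemma vertex_points: "u \<in> verts G \<Longrightarrow> vertex_point u \<in> points G"
  unfolding points_def by blast

lemma points_cases [consumes 1, case_names vertex interior]:
  assumes "p \<in> points G"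
    and vertex: "\<And>u. u \<in> verts G \<Longrightarrow> p = vertex_point u \<Longrightarrow> P"
    and interior: "\<And>u v t. adj u v \<Longrightarrow> 0 < t \<Longrightarrow> t < elen u v \<Longrightarrow> p = ep u v t \<Longrightarrow> P"
  shows P
proof (cases "p \<in> vertex_point ` verts G")
  case True
  then show ?thesis using vertex by blast
next
  case False
  then obtain u v t where *: "adj u v" "0 \<le> t" "t \<le> elen u v" "p = ep u v t"
    using assms(1) unfolding points_def by blast
  then have "t \<noteq> 0" "t \<noteq> elen u v" using False adj_verts ep_0 ep_elen by blast+
  then show ?thesis using interior[of u v t] * by auto
qed

lemma points_arc:
  assumes "p \<in> points G"
  shows "\<exists>u v t. adj u v \<and> 0 \<le> t \<and> t < elen u v \<and> p = ep u v t"
  using assms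
proof (cases rule: points_cases)
  case (vertex u)
  then obtain v where "adj u v" using verts_adj by blast
  then show ?thesis using vertex elen_pos[of u v] ep_0[of u v]
    by (intro exI[of _ u] exI[of _ v] exI[of _ 0]) auto
next
  case (interior u v t)
  then show ?thesis by (intro exI[of _ u] exI[of _ v] exI[of _ t]) auto
qed

lemma directions_vertex: "directions G (vertex_point u) = (\<lambda>v. (u, v, 0)) ` {v. adj u v}"
proof -
  have "(x, y, t) \<in> directions G (vertex_point u) \<longleftrightarrow> x = u \<and> t = 0 \<and> adj u y" for x y t
    using ep_eq_vertex[of x y t u] elen_pos[of u y] by (auto simp: directions_def)
  then show ?thesis by auto
qed

lemma directions_interior:
  assumes "adj u v" "0 < t" "t < elen u v"
  shows "directions G (ep u v t) = {(u, v, t), (v, u, elen u v - t)}"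
proof -
  have "(x, y, s) \<in> directions G (ep u v t) \<longleftrightarrow>
        (x = u \<and> y = v \<and> s = t) \<or> (x = v \<and> y = u \<and> s = elen u v - t)" for x y s
  proof -
    have "(x, y, s) \<in> directions G (ep u v t) \<longleftrightarrow>
        adj x y \<and> 0 \<le> s \<and> s < elen x y \<and> ep x y s = ep u v t"
      by (simp add: directions_def)
    also have "\<dots> \<longleftrightarrow> adj x y \<and> 0 \<le> s \<and> s < elen x y \<and>
        ((x = u \<and> y = v \<and> s = t) \<or> (x = v \<and> y = u \<and> s = elen u v - t))"
      using ep_eq_interior[OF assms, of x y s] by auto
    also have "\<dots> \<longleftrightarrow> (x = u \<and> y = v \<and> s = t) \<or> (x = v \<and> y = u \<and> s = elen u v - t)"
      using assms adj_sym[OF assms(1)] elen_sym[of v u] by auto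
    finally show ?thesis .
  qed
  then show ?thesis by auto
qed

lemma finite_nbrs: "finite {v. adj u v}"
  by (rule finite_subset[OF _ finite_verts]) (auto dest: adj_verts)

lemma finite_directions: "p \<in> points G \<Longrightarrow> finite (directions G p)"
  by (cases rule: points_cases) (auto simp: directions_vertex directions_interior finite_nbrs)

lemma directionsD:
  "(u, v, t) \<in> directions G p \<Longrightarrow> adj u v \<and> 0 \<le> t \<and> t < elen u v \<and> p = ep u v t"
  by (auto simp: directions_def)

lemma directionsI:
  "adj u v \<Longrightarrow> 0 \<le> t \<Longrightarrow> t < elen u v \<Longrightarrow> (u, v, t) \<in> directions G (ep u v t)"
  by (auto simp: directions_def)

subsection \<open>Topology\<close>

text \<open>The closed edge from \<open>u\<close> to \<open>v\<close> as a set of points.\<close>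

definition segment :: "'v \<Rightarrow> 'v \<Rightarrow> 'v point set" where
  "segment u v = ep u v ` {0..elen u v}"

lemma continuous_ep: "continuous_on A (ep u v)"
  unfolding edge_point_def divide_inverse
  by (intro continuous_on_coordinatewise_then_product continuous_intros)

lemma connected_segment: "connected (segment u v)"
  unfolding segment_def by (intro connected_continuous_image continuous_ep) auto

lemma points_segments: "points G = (\<Union>(u, v)\<in>arcs. segment u v)"
proof (intro set_eqI iffI)
  fix p assume "p \<in> points G"
  then obtain u v t where "adj u v" "0 \<le> t" "t < elen u v" "p = ep u v t" using points_arc by blast
  then show "p \<in> (\<Union>(u, v)\<in>arcs. segment u v)" unfolding arcs_def segment_def by force
next
  fix p assume "p \<in> (\<Union>(u, v)\<in>arcs. segment u v)"
  then show "p \<in> points G" unfolding arcs_def segment_def using ep_points by auto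
qed

lemma closed_edge_segment:
  assumes "adj u v"
  shows "closed (segment u v)"
proof -
  have c: "continuous_on UNIV (\<lambda>p::'v point. p w)" for w
    by (rule continuous_on_product_coordinates)
  have "segment u v = {p. p u + p v = 1 \<and> 0 \<le> p u \<and> 0 \<le> p v \<and> (\<forall>w. w \<notin> {u, v} \<longrightarrow> p w = 0)}"
    (is "_ = ?R")
  proof (intro set_eqI iffI)
    fix p assume "p \<in> segment u v"
    then obtain t where "0 \<le> t" "t \<le> elen u v" "p = ep u v t" unfolding segment_def by auto
    then show "p \<in> ?R"
      using assms elen_pos[OF assms] by (auto simp: ep_fst ep_snd ep_other)
  next
    fix p assume p: "p \<in> ?R"
    have "p w = ep u v (elen u v * p v) w" for w
    proof -
      consider "w = u" | "w = v" | "w \<noteq> u" "w \<noteq> v" by blast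
      then show ?thesis
      proof cases
        case 1
        then show ?thesis using p ep_fst[OF assms] elen_pos[OF assms] by auto
      next
        case 2
        then show ?thesis using ep_snd[OF assms] elen_pos[OF assms] by auto
      next
        case 3
        then show ?thesis using p by (auto simp: ep_other)
      qed
    qed
    then have "p = ep u v (elen u v * p v)" by blast
    moreover have "elen u v * p v \<in> {0..elen u v}"
      using p elen_pos[OF assms] by (auto intro!: mult_nonneg_nonneg mult_left_le)
    ultimately show "p \<in> segment u v" unfolding segment_def by blast
  qed
  moreover have "closed ?R"
    by (intro closed_Collect_conj closed_Collect_all closed_Collect_imp closed_Collect_eq
        closed_Collect_le continuous_intros c) auto
  ultimately show ?thesis by simp
qed

text \<open>
  The realization is a finite union of closed edges, each of them homeomorphic to an interval by its
  coordinate at one end.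
\<close>

lemma continuous_on_points_iff:
  "continuous_on (points G) (f :: 'v point \<Rightarrow> real) \<longleftrightarrow>
     (\<forall>u v. adj u v \<longrightarrow> continuous_on {0..elen u v} (\<lambda>t. f (ep u v t)))"
proof
  assume f: "continuous_on (points G) f"
  show "\<forall>u v. adj u v \<longrightarrow> continuous_on {0..elen u v} (\<lambda>t. f (ep u v t))"
  proof (intro allI impI)
    fix u v assume "adj u v"
    then have "ep u v ` {0..elen u v} \<subseteq> points G" using ep_points by auto
    then show "continuous_on {0..elen u v} (\<lambda>t. f (ep u v t))"
      using continuous_on_compose2[OF f continuous_ep] by blast
  qed
next
  assume f: "\<forall>u v. adj u v \<longrightarrow> continuous_on {0..elen u v} (\<lambda>t. f (ep u v t))"
  have "continuous_on (segment u v) f" if uv: "adj u v" for u v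
  proof -
    have "continuous_on (segment u v) (\<lambda>p. f (ep u v (elen u v * p v)))"
    proof (rule continuous_on_compose2[OF f[rule_format, OF uv]])
      show "continuous_on (segment u v) (\<lambda>p. elen u v * p v)"
        by (intro continuous_intros continuous_on_subset[OF continuous_on_product_coordinates]) auto
      show "(\<lambda>p. elen u v * p v) ` segment u v \<subseteq> {0..elen u v}"
        using uv elen_pos[OF uv] by (auto simp: segment_def ep_snd)
    qed
    moreover have "f (ep u v (elen u v * p v)) = f p" if "p \<in> segment u v" for p
      using that uv elen_pos[OF uv] by (auto simp: segment_def ep_snd)
    ultimately show ?thesis by (simp cong: continuous_on_cong)
  qed
  then show "continuous_on (points G) f"
    unfolding points_segments
    by (intro continuous_on_closed_Union finite_arcs) (auto simp: arcs_def closed_edge_segment)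
qed

end

section \<open>Piecewise linear functions\<close>

text \<open>
  \<open>g\<close> is affine with the integer slope \<open>m\<close> on some interval starting at \<open>t\<close>. This is stronger than having \<open>m\<close> as
  a right derivative.
\<close>

definition right_slope :: "(real \<Rightarrow> real) \<Rightarrow> real \<Rightarrow> int \<Rightarrow> bool" where
  "right_slope g t m \<longleftrightarrow> (\<exists>e>0. \<forall>s\<in>{t..t + e}. g s = g t + of_int m * (s - t))"

lemma right_slopeI:
  assumes "0 < e" "\<And>s. t \<le> s \<Longrightarrow> s \<le> t + e \<Longrightarrow> g s = g t + of_int m * (s - t)"
  shows "right_slope g t m"
  unfolding right_slope_def using assms by (meson atLeastAtMost_iff)

lemma right_slopeE:
  assumes "right_slope g t m"
  obtains e where "0 < e" "\<And>s. t \<le> s \<Longrightarrow> s \<le> t + e \<Longrightarrow> g s = g t + of_int m * (s - t)"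
  using assms unfolding right_slope_def by (meson atLeastAtMost_iff)

lemma right_slope_vector_derivative:
  assumes "right_slope g t m"
  shows "vector_derivative g (at_right t) = of_int m"
proof -
  obtain e where e: "0 < e" "\<And>s. t \<le> s \<Longrightarrow> s \<le> t + e \<Longrightarrow> g s = g t + of_int m * (s - t)"
    using right_slopeE[OF assms] by blast
  have "((\<lambda>s. g t + of_int m * (s - t)) has_real_derivative of_int m) (at t within {t..})"
    by (auto intro!: derivative_eq_intros)
  then have "((\<lambda>s. g t + of_int m * (s - t)) has_vector_derivative of_int m) (at t within {t..})"
    by (simp add: has_real_derivative_iff_has_vector_derivative)
  then have "(g has_vector_derivative of_int m) (at t within {t..})"
  proof (rule has_vector_derivative_transform_within)
    show "0 < e" by fact
    show "g t + of_int m * (x - t) = g x" if "x \<in> {t..}" "dist x t < e" for x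
      using e(2)[of x] that by (auto simp: dist_real_def)
  qed simp
  then have "(g has_vector_derivative of_int m) (at_right t)"
    by (rule has_vector_derivative_within_subset) auto
  then show ?thesis
    by (rule vector_derivative_within[rotated]) simp
qed

lemma right_slope_add:
  assumes "right_slope g t m" "right_slope h t n"
  shows "right_slope (\<lambda>s. g s + h s) t (m + n)"
proof -
  obtain e1 where e1: "0 < e1" "\<And>s. t \<le> s \<Longrightarrow> s \<le> t + e1 \<Longrightarrow> g s = g t + of_int m * (s - t)"
    using right_slopeE[OF assms(1)] by blast
  obtain e2 where e2: "0 < e2" "\<And>s. t \<le> s \<Longrightarrow> s \<le> t + e2 \<Longrightarrow> h s = h t + of_int n * (s - t)"
    using right_slopeE[OF assms(2)] by blast
  show ?thesis
  proof (rule right_slopeI)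
    show "0 < min e1 e2" using e1(1) e2(1) by simp
    show "g s + h s = g t + h t + of_int (m + n) * (s - t)" if "t \<le> s" "s \<le> t + min e1 e2" for s
      using e1(2)[of s] e2(2)[of s] that by (simp add: distrib_right)
  qed
qed

lemma right_slope_uminus:
  assumes "right_slope g t m"
  shows "right_slope (\<lambda>s. - g s) t (- m)"
proof -
  obtain e where e: "0 < e" "\<And>s. t \<le> s \<Longrightarrow> s \<le> t + e \<Longrightarrow> g s = g t + of_int m * (s - t)"
    using right_slopeE[OF assms] by blast
  show ?thesis
  proof (rule right_slopeI[OF e(1)])
    show "- g s = - g t + of_int (- m) * (s - t)" if "t \<le> s" "s \<le> t + e" for s
      using e(2)[OF that] by simp
  qed
qed

lemma right_slope_max:
  assumes "right_slope g t m"
  shows "right_slope (\<lambda>s. max (g s) c) t (if c < g t then m else if g t = c then max m 0 else 0)"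
proof -
  obtain e where e: "0 < e" "\<And>s. t \<le> s \<Longrightarrow> s \<le> t + e \<Longrightarrow> g s = g t + of_int m * (s - t)"
    using right_slopeE[OF assms] by blast
  show ?thesis
  proof (cases "g t = c")
    case True
    have "max (g s) c = max (g t) c + of_int (max m 0) * (s - t)" if s: "t \<le> s" "s \<le> t + e" for s
    proof (cases "0 \<le> m")
      case True
      then have "0 \<le> of_int m * (s - t)" using s by (intro mult_nonneg_nonneg) auto
      then show ?thesis using e(2)[OF s] \<open>g t = c\<close> True by simp
    next
      case False
      then have "of_int m * (s - t) \<le> 0" using s by (intro mult_nonpos_nonneg) auto
      then show ?thesis using e(2)[OF s] \<open>g t = c\<close> False by simp
    qed
    then have "right_slope (\<lambda>s. max (g s) c) t (max m 0)" by (rule right_slopeI[OF e(1)])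
    then show ?thesis using True by simp
  next
    case False
    define d where "d = min e (\<bar>g t - c\<bar> / (\<bar>of_int m\<bar> + 1))"
    have d: "0 < d" "d \<le> e" using e(1) False by (auto simp: d_def)
    have *: "\<bar>g s - g t\<bar> < \<bar>g t - c\<bar>" if s: "t \<le> s" "s \<le> t + d" for s
    proof -
      have "\<bar>g s - g t\<bar> = \<bar>of_int m\<bar> * (s - t)" using e(2)[of s] s d by (simp add: abs_mult)
      also have "\<dots> \<le> \<bar>of_int m\<bar> * (\<bar>g t - c\<bar> / (\<bar>of_int m\<bar> + 1))"
        using s by (intro mult_left_mono) (auto simp: d_def)
      also have "\<dots> < \<bar>g t - c\<bar>" using False by (simp add: field_simps)
      finally show ?thesis .
    qed
    show ?thesis
    proof (rule right_slopeI[OF d(1)])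
      fix s assume s: "t \<le> s" "s \<le> t + d"
      show "max (g s) c = max (g t) c +
          of_int (if c < g t then m else if g t = c then max m 0 else 0) * (s - t)"
      proof (cases "c < g t")
        case True
        then have "c < g s" using *[OF s] by linarith
        then show ?thesis using e(2)[of s] s d True by simp
      next
        case c: False
        then have "g s < c" using *[OF s] False by linarith
        then show ?thesis using c False by simp
      qed
    qed
  qed
qed

text \<open>
  Finitely many pieces with integer slopes on \<open>[0, L]\<close>, in the form in which rational functions on a graph
  are described: \<open>B\<close> contains all break points.
\<close>

definition piecewise_linear :: "real \<Rightarrow> (real \<Rightarrow> real) \<Rightarrow> bool" where
  "piecewise_linear L g \<longleftrightarrow> (\<exists>B. finite B \<and>
     (\<forall>a b. 0 \<le> a \<and> a < b \<and> b \<le> L \<and> {a<..<b} \<inter> B = {} \<longrightarrow>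
        (\<exists>(m::int) (c::real). \<forall>t\<in>{a<..<b}. g t = of_int m * t + c)))"

lemma piecewise_linearE:
  assumes "piecewise_linear L g"
  obtains B where "finite B"
    "\<And>a b. 0 \<le> a \<Longrightarrow> a < b \<Longrightarrow> b \<le> L \<Longrightarrow> {a<..<b} \<inter> B = {} \<Longrightarrow>
       \<exists>(m::int) (c::real). \<forall>t\<in>{a<..<b}. g t = of_int m * t + c"
  using assms unfolding piecewise_linear_def by (elim exE conjE) simp

text \<open>
  Local linearity on both sides of every point of a compact interval gives finitely many pieces,
  by compactness.
\<close>

lemma piecewise_linear_of_local:
  fixes g :: "real \<Rightarrow> real"
  assumes L: "0 \<le> L"
    and loc: "\<And>x. 0 \<le> x \<Longrightarrow> x \<le> L \<Longrightarrow> \<exists>e>0. \<exists>(m::int) (n::int).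
        (\<forall>s. 0 \<le> s \<and> s \<le> L \<and> x \<le> s \<and> s \<le> x + e \<longrightarrow> g s = g x + of_int m * (s - x)) \<and>
        (\<forall>s. 0 \<le> s \<and> s \<le> L \<and> x - e \<le> s \<and> s \<le> x \<longrightarrow> g s = g x + of_int n * (s - x))"
  shows "continuous_on {0..L} g \<and> piecewise_linear L g"
proof -
  define P where "P l r \<longleftrightarrow> (0 \<le> l \<longrightarrow> r \<le> L \<longrightarrow> continuous_on {l..r} g \<and> (\<exists>B. finite B \<and>
     (\<forall>a b. l \<le> a \<and> a < b \<and> b \<le> r \<and> {a<..<b} \<inter> B = {} \<longrightarrow>
        (\<exists>(m::int) (c::real). \<forall>t\<in>{a<..<b}. g t = of_int m * t + c))))" for l r
  have trans: "P l r" if 1: "P l x" "P x r" and le: "l \<le> x" "x \<le> r" for l x r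
    unfolding P_def
  proof (intro impI conjI)
    assume b: "0 \<le> l" "r \<le> L"
    have "continuous_on ({l..x} \<union> {x..r}) g"
      by (rule continuous_on_closed_Un) (use 1 le b in \<open>auto simp: P_def\<close>)
    then show "continuous_on {l..r} g" using le by (simp add: ivl_disj_un)
    obtain B1 where B1: "finite B1" "\<And>a b. l \<le> a \<Longrightarrow> a < b \<Longrightarrow> b \<le> x \<Longrightarrow> {a<..<b} \<inter> B1 = {} \<Longrightarrow>
        (\<exists>(m::int) (c::real). \<forall>t\<in>{a<..<b}. g t = of_int m * t + c)"
      using 1(1) le b unfolding P_def by (meson order_trans)
    obtain B2 where B2: "finite B2" "\<And>a b. x \<le> a \<Longrightarrow> a < b \<Longrightarrow> b \<le> r \<Longrightarrow> {a<..<b} \<inter> B2 = {} \<Longrightarrow>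
        (\<exists>(m::int) (c::real). \<forall>t\<in>{a<..<b}. g t = of_int m * t + c)"
      using 1(2) le b unfolding P_def by (meson order_trans)
    have "\<exists>(m::int) (c::real). \<forall>t\<in>{a<..<b}. g t = of_int m * t + c"
      if "l \<le> a" "a < b" "b \<le> r" "{a<..<b} \<inter> insert x (B1 \<union> B2) = {}" for a b
    proof -
      have "x \<notin> {a<..<b}" using that by blast
      then have "b \<le> x \<or> x \<le> a" by auto
      then show ?thesis using B1(2)[of a b] B2(2)[of a b] that by blast
    qed
    then show "\<exists>B. finite B \<and> (\<forall>a b. l \<le> a \<and> a < b \<and> b \<le> r \<and> {a<..<b} \<inter> B = {} \<longrightarrow>
        (\<exists>(m::int) (c::real). \<forall>t\<in>{a<..<b}. g t = of_int m * t + c))"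
      using B1(1) B2(1) by (intro exI[of _ "insert x (B1 \<union> B2)"]) auto
  qed
  have affine: "P l r" if A: "\<And>s. l \<le> s \<Longrightarrow> s \<le> r \<Longrightarrow> 0 \<le> s \<Longrightarrow> s \<le> L \<Longrightarrow> g s = g x + of_int m * (s - x)"
    for l r x and m :: int
    unfolding P_def
  proof (intro impI conjI)
    assume b: "0 \<le> l" "r \<le> L"
    have eq: "g s = of_int m * s + (g x - of_int m * x)" if "s \<in> {l..r}" for s
      using A[of s] that b by (simp add: algebra_simps)
    have "continuous_on {l..r} (\<lambda>s. of_int m * s + (g x - of_int m * x))"
      by (intro continuous_intros)
    then show "continuous_on {l..r} g" using eq by (rule continuous_on_eq[OF _ sym])
    show "\<exists>B. finite B \<and> (\<forall>a b. l \<le> a \<and> a < b \<and> b \<le> r \<and> {a<..<b} \<inter> B = {} \<longrightarrow>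
        (\<exists>(m::int) (c::real). \<forall>t\<in>{a<..<b}. g t = of_int m * t + c))"
      by (rule exI[of _ "{}"], simp, intro allI impI exI[of _ m] exI[of _ "g x - of_int m * x"])
        (use eq in auto)
  qed
  have "P 0 L"
    using L
  proof (induction rule: Bolzano)
    case (trans a b c)
    then show ?case using \<open>\<And>l x r. P l x \<Longrightarrow> P x r \<Longrightarrow> l \<le> x \<Longrightarrow> x \<le> r \<Longrightarrow> P l r\<close> by blast
  next
    case (local x)
    obtain e m n where e: "e > 0"
        "\<And>s. 0 \<le> s \<Longrightarrow> s \<le> L \<Longrightarrow> x \<le> s \<Longrightarrow> s \<le> x + e \<Longrightarrow> g s = g x + of_int (m::int) * (s - x)"
        "\<And>s. 0 \<le> s \<Longrightarrow> s \<le> L \<Longrightarrow> x - e \<le> s \<Longrightarrow> s \<le> x \<Longrightarrow> g s = g x + of_int (n::int) * (s - x)"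
      using loc[OF local] by blast
    have "P a b" if "a \<le> x" "x \<le> b" "b - a < e" for a b
    proof (rule trans[of a x b])
      show "P a x" by (rule affine[of a x x n]) (use e(3) that in auto)
      show "P x b" by (rule affine[of x b x m]) (use e(2) that in auto)
    qed (use that in auto)
    then show ?case using e(1) by blast
  qed
  then show ?thesis unfolding P_def piecewise_linear_def by simp
qed

lemma affine_closed_interval:
  fixes g :: "real \<Rightarrow> real"
  assumes "a < b" "continuous_on {a..b} g" "\<And>s. s \<in> {a<..<b} \<Longrightarrow> g s = m * s + c" "s \<in> {a..b}"
  shows "g s = m * s + c"
proof -
  have cl: "closure {a<..<b} = {a..b}" using assms(1) by simp
  have "g s - m * s = c"
  proof (rule continuous_constant_on_closure[of "{a<..<b}" "\<lambda>s. g s - m * s"])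
    show "continuous_on (closure {a<..<b}) (\<lambda>s. g s - m * s)"
      unfolding cl by (intro continuous_intros assms(2))
    show "g x - m * x = c" if "x \<in> {a<..<b}" for x using assms(3)[OF that] by simp
    show "s \<in> closure {a<..<b}" using assms(4) cl by simp
  qed
  then show ?thesis by simp
qed

text \<open>
  The outward slopes at the break points and the ends of an interval cancel; \<open>R\<close> and \<open>S\<close> are the slopes to
  the right and to the left, both in outward direction, and \<open>T\<close> may contain more than the break points.
\<close>

lemma sum_slopes_interval:
  fixes R S :: "real \<Rightarrow> real"
  assumes piece: "\<And>a b. l \<le> a \<Longrightarrow> a < b \<Longrightarrow> b \<le> r \<Longrightarrow> {a<..<b} \<inter> B = {} \<Longrightarrow>
        \<exists>m. (\<forall>t\<in>{a..<b}. R t = m) \<and> (\<forall>t\<in>{a<..b}. S t = - m)"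
    and "finite T" "l \<le> a" "a < b" "b \<le> r" "{a<..<b} \<inter> B \<subseteq> T" "T \<subseteq> {a<..<b}"
  shows "R a + (\<Sum>t\<in>T. R t + S t) + S b = 0"
  using assms(2-)
proof (induction "card T" arbitrary: T a b rule: less_induct)
  case less
  show ?case
  proof (cases "T = {}")
    case True
    then obtain m where "\<forall>t\<in>{a..<b}. R t = m" "\<forall>t\<in>{a<..b}. S t = - m"
      using piece[of a b] less.prems by auto
    then show ?thesis using True less.prems by auto
  next
    case False
    then obtain x where x: "x \<in> T" by blast
    then have ax: "a < x" "x < b" using less.prems by auto
    define T1 T2 where "T1 = T \<inter> {a<..<x}" and "T2 = T \<inter> {x<..<b}"
    have T: "T = insert x (T1 \<union> T2)" "x \<notin> T1" "x \<notin> T2" "T1 \<inter> T2 = {}"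
      using less.prems x by (auto simp: T1_def T2_def)
    have fin: "finite T1" "finite T2" using less.prems by (auto simp: T1_def T2_def)
    have "card T1 < card T" "card T2 < card T"
      using less.prems(1) x by (auto intro!: psubset_card_mono simp: T1_def T2_def)
    moreover have "{a<..<x} \<inter> B \<subseteq> {a<..<b} \<inter> B" "{x<..<b} \<inter> B \<subseteq> {a<..<b} \<inter> B"
      using ax by auto
    then have "{a<..<x} \<inter> B \<subseteq> T1" "{x<..<b} \<inter> B \<subseteq> T2"
      using less.prems(5) by (auto simp: T1_def T2_def)
    ultimately have "R a + (\<Sum>t\<in>T1. R t + S t) + S x = 0" "R x + (\<Sum>t\<in>T2. R t + S t) + S b = 0"
      using less.hyps[of T1 a x] less.hyps[of T2 x b] less.prems fin ax
      by (auto simp: T1_def T2_def)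
    moreover have "(\<Sum>t\<in>T. R t + S t) = R x + S x + (\<Sum>t\<in>T1. R t + S t) + (\<Sum>t\<in>T2. R t + S t)"
      unfolding T(1) using T(2-) fin by (simp add: sum.union_disjoint)
    ultimately show ?thesis by linarith
  qed
qed

context finite_metric_graph
begin

text \<open>
  Local linearity in every direction. As an edge can be traversed both ways, this covers both sides of
  each of its points.
\<close>

definition pl :: "('v point \<Rightarrow> real) \<Rightarrow> bool" where
  "pl f \<longleftrightarrow> (\<forall>u v t. adj u v \<and> 0 \<le> t \<and> t < elen u v \<longrightarrow> (\<exists>m. right_slope (\<lambda>s. f (ep u v s)) t m))"

lemma plD: "pl f \<Longrightarrow> adj u v \<Longrightarrow> 0 \<le> t \<Longrightarrow> t < elen u v \<Longrightarrow> \<exists>m. right_slope (\<lambda>s. f (ep u v s)) t m"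
  unfolding pl_def by blast

lemma outgoing_slope_eq: "right_slope (\<lambda>s. f (ep u v s)) t m \<Longrightarrow> outgoing_slope G f (u, v, t) = of_int m"
  unfolding outgoing_slope_def using right_slope_vector_derivative by auto

lemma pl_directions:
  assumes "pl f" "\<tau> \<in> directions G p"
  shows "\<exists>u v t m. \<tau> = (u, v, t) \<and> adj u v \<and> 0 \<le> t \<and> t < elen u v \<and> p = ep u v t \<and>
           right_slope (\<lambda>s. f (ep u v s)) t m \<and> outgoing_slope G f \<tau> = of_int m"
proof -
  obtain u v t where \<tau>: "\<tau> = (u, v, t)" by (cases \<tau>)
  then have *: "adj u v" "0 \<le> t" "t < elen u v" "p = ep u v t" using directionsD assms(2) by blast+
  then obtain m where "right_slope (\<lambda>s. f (ep u v s)) t m" using plD[OF assms(1)] by blast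
  with * \<tau> outgoing_slope_eq show ?thesis by blast
qed

lemma rational_function_iff:
  "rational_function G f \<longleftrightarrow>
     (\<forall>u v. adj u v \<longrightarrow> continuous_on {0..elen u v} (\<lambda>t. f (ep u v t)) \<and>
        piecewise_linear (elen u v) (\<lambda>t. f (ep u v t)))"
  unfolding rational_function_def continuous_on_points_iff piecewise_linear_def
  by (simp only: imp_conjR all_conj_distrib)

lemma rational_imp_pl:
  assumes f: "rational_function G f"
  shows "pl f"
  unfolding pl_def
proof (intro allI impI)
  fix u v t assume A: "adj u v \<and> 0 \<le> t \<and> t < elen u v"
  define g where "g = (\<lambda>s. f (ep u v s))"
  have cont: "continuous_on {0..elen u v} g" and pw: "piecewise_linear (elen u v) g"
    using f A unfolding rational_function_iff g_def by simp_all
  obtain B where B: "finite B" "\<And>a b. 0 \<le> a \<Longrightarrow> a < b \<Longrightarrow> b \<le> elen u v \<Longrightarrow> {a<..<b} \<inter> B = {} \<Longrightarrow>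
         \<exists>(m::int) (c::real). \<forall>t\<in>{a<..<b}. g t = of_int m * t + c"
    by (rule piecewise_linearE[OF pw], rule that)
  define b where "b = Min (insert (elen u v) (B \<inter> {t<..}))"
  have fin: "finite (insert (elen u v) (B \<inter> {t<..}))" using B(1) by simp
  have "b \<in> insert (elen u v) (B \<inter> {t<..})" unfolding b_def by (rule Min_in[OF fin]) simp
  then have b: "t < b" using A by auto
  have b': "b \<le> elen u v" unfolding b_def by (rule Min_le[OF fin]) simp
  have "b \<le> x" if "x \<in> B" "t < x" for x
    unfolding b_def by (rule Min_le[OF fin]) (use that in simp)
  then have "{t<..<b} \<inter> B = {}" by fastforce
  then obtain m c where mc: "\<And>s. s \<in> {t<..<b} \<Longrightarrow> g s = of_int m * s + c"
    using B(2)[of t b] A b b' by blast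
  have "continuous_on {t..b} g"
    using A b b' by (intro continuous_on_subset[OF cont]) auto
  then have *: "g s = of_int m * s + c" if "t \<le> s" "s \<le> b" for s
    using affine_closed_interval[OF b _ mc] that by auto
  have "right_slope g t m"
  proof (rule right_slopeI)
    show "0 < b - t" using b by simp
    show "g s = g t + of_int m * (s - t)" if "t \<le> s" "s \<le> t + (b - t)" for s
      using *[of s] *[of t] b that by (simp add: algebra_simps)
  qed
  then show "\<exists>m. right_slope (\<lambda>s. f (ep u v s)) t m" unfolding g_def by blast
qed

lemma pl_two_sided:
  assumes "pl f" "adj u v" "0 \<le> x" "x \<le> elen u v"
  defines "g \<equiv> \<lambda>s. f (ep u v s)"
  shows "\<exists>e>0. \<exists>(m::int) (n::int).
        (\<forall>s. 0 \<le> s \<and> s \<le> elen u v \<and> x \<le> s \<and> s \<le> x + e \<longrightarrow> g s = g x + of_int m * (s - x)) \<and>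
        (\<forall>s. 0 \<le> s \<and> s \<le> elen u v \<and> x - e \<le> s \<and> s \<le> x \<longrightarrow> g s = g x + of_int n * (s - x))"
proof -
  have "\<exists>e>0. \<exists>m::int. \<forall>s. 0 \<le> s \<and> s \<le> elen u v \<and> x \<le> s \<and> s \<le> x + e \<longrightarrow> g s = g x + of_int m * (s - x)"
  proof (cases "x < elen u v")
    case True
    then obtain m where "right_slope g x m" using plD[OF assms(1,2,3)] unfolding g_def by blast
    then show ?thesis by (elim right_slopeE) blast
  next
    case False
    then show ?thesis using assms(4) by (intro exI[of _ 1]) auto
  qed
  then obtain e1 m where e1: "e1 > 0"
      "\<And>s. 0 \<le> s \<Longrightarrow> s \<le> elen u v \<Longrightarrow> x \<le> s \<Longrightarrow> s \<le> x + e1 \<Longrightarrow> g s = g x + of_int (m::int) * (s - x)"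
    by blast
  have "\<exists>e>0. \<exists>n::int. \<forall>s. 0 \<le> s \<and> s \<le> elen u v \<and> x - e \<le> s \<and> s \<le> x \<longrightarrow> g s = g x + of_int n * (s - x)"
  proof (cases "0 < x")
    case True
    have "0 \<le> elen u v - x" "elen u v - x < elen v u" using assms True elen_sym[of u v] by auto
    then obtain n where "right_slope (\<lambda>s. f (ep v u s)) (elen u v - x) n"
      using plD[OF assms(1) adj_sym[OF assms(2)]] by blast
    then obtain e where e: "0 < e" "\<And>s. elen u v - x \<le> s \<Longrightarrow> s \<le> elen u v - x + e \<Longrightarrow>
        f (ep v u s) = f (ep v u (elen u v - x)) + of_int n * (s - (elen u v - x))"
      by (elim right_slopeE) blast
    have "g s = g x + of_int (- n) * (s - x)" if "x - e \<le> s" "s \<le> x" for s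
      using e(2)[of "elen u v - s"] that by (simp add: ep_swap[OF assms(2)] g_def algebra_simps)
    then show ?thesis using e(1) by blast
  next
    case False
    then show ?thesis using assms(3) by (intro exI[of _ 1]) auto
  qed
  then obtain e2 n where e2: "e2 > 0"
      "\<And>s. 0 \<le> s \<Longrightarrow> s \<le> elen u v \<Longrightarrow> x - e2 \<le> s \<Longrightarrow> s \<le> x \<Longrightarrow> g s = g x + of_int (n::int) * (s - x)"
    by blast
  show ?thesis
  proof (rule exI[of _ "min e1 e2"], rule conjI, use e1(1) e2(1) in simp,
      rule exI[of _ m], rule exI[of _ n], intro conjI allI impI)
    show "g s = g x + of_int m * (s - x)"
      if "0 \<le> s \<and> s \<le> elen u v \<and> x \<le> s \<and> s \<le> x + min e1 e2" for s
      using that by (intro e1(2)) auto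
    show "g s = g x + of_int n * (s - x)"
      if "0 \<le> s \<and> s \<le> elen u v \<and> x - min e1 e2 \<le> s \<and> s \<le> x" for s
      using that by (intro e2(2)) auto
  qed
qed

lemma pl_imp_rational:
  assumes "pl f"
  shows "rational_function G f"
  unfolding rational_function_iff
proof (intro allI impI)
  fix u v assume uv: "adj u v"
  show "continuous_on {0..elen u v} (\<lambda>t. f (ep u v t)) \<and> piecewise_linear (elen u v) (\<lambda>t. f (ep u v t))"
    by (rule piecewise_linear_of_local[OF less_imp_le[OF elen_pos[OF uv]]])
      (rule pl_two_sided[OF assms uv])
qed

theorem rational_iff_pl: "rational_function G f \<longleftrightarrow> pl f"
  using rational_imp_pl pl_imp_rational by blast

lemma pl_continuous: "pl f \<Longrightarrow> adj u v \<Longrightarrow> continuous_on {0..elen u v} (\<lambda>t. f (ep u v t))"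
  using pl_imp_rational[of f] unfolding rational_function_iff by simp

lemma pl_add: "pl f \<Longrightarrow> pl g \<Longrightarrow> pl (\<lambda>p. f p + g p)"
  unfolding pl_def using right_slope_add by meson

lemma pl_uminus: "pl f \<Longrightarrow> pl (\<lambda>p. - f p)"
  unfolding pl_def using right_slope_uminus by meson

lemma pl_max: "pl f \<Longrightarrow> pl (\<lambda>p. max (f p) c)"
  unfolding pl_def using right_slope_max by meson

text \<open>Slopes are constant on the finitely many pieces of an edge.\<close>

lemma pl_pieces:
  assumes f: "pl f" and uv: "adj u v"
  shows "\<exists>B. finite B \<and> (\<forall>a b. 0 \<le> a \<and> a < b \<and> b \<le> elen u v \<and> {a<..<b} \<inter> B = {} \<longrightarrow>
     (\<exists>m. (\<forall>t\<in>{a..<b}. outgoing_slope G f (u, v, t) = m) \<and>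
          (\<forall>t\<in>{a<..b}. outgoing_slope G f (v, u, elen u v - t) = - m)))"
proof -
  define g where "g = (\<lambda>s. f (ep u v s))"
  have cont: "continuous_on {0..elen u v} g" and pw: "piecewise_linear (elen u v) g"
    using pl_imp_rational[OF f] uv unfolding rational_function_iff g_def by simp_all
  obtain B where B: "finite B" "\<And>a b. 0 \<le> a \<Longrightarrow> a < b \<Longrightarrow> b \<le> elen u v \<Longrightarrow> {a<..<b} \<inter> B = {} \<Longrightarrow>
         \<exists>(m::int) (c::real). \<forall>t\<in>{a<..<b}. g t = of_int m * t + c"
    by (rule piecewise_linearE[OF pw], rule that)
  have "\<exists>m. (\<forall>t\<in>{a..<b}. outgoing_slope G f (u, v, t) = m) \<and>
            (\<forall>t\<in>{a<..b}. outgoing_slope G f (v, u, elen u v - t) = - m)"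
    if ab: "0 \<le> a" "a < b" "b \<le> elen u v" "{a<..<b} \<inter> B = {}" for a b
  proof -
    obtain m c where mc: "\<And>s. s \<in> {a<..<b} \<Longrightarrow> g s = of_int m * s + c"
      using B(2)[OF ab] by blast
    have "continuous_on {a..b} g"
      using ab by (intro continuous_on_subset[OF cont]) auto
    then have *: "g s = of_int m * s + c" if "a \<le> s" "s \<le> b" for s
      using affine_closed_interval[OF ab(2) _ mc] that by auto
    have "outgoing_slope G f (u, v, t) = of_int m" if t: "a \<le> t" "t < b" for t
    proof (rule outgoing_slope_eq)
      show "right_slope (\<lambda>s. f (ep u v s)) t m"
      proof (rule right_slopeI)
        show "0 < b - t" using t by simp
        show "f (ep u v s) = f (ep u v t) + of_int m * (s - t)" if "t \<le> s" "s \<le> t + (b - t)" for s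
          using *[of s] *[of t] t that by (simp add: algebra_simps g_def)
      qed
    qed
    moreover have "outgoing_slope G f (v, u, elen u v - t) = of_int (- m)" if t: "a < t" "t \<le> b" for t
    proof (rule outgoing_slope_eq)
      show "right_slope (\<lambda>s. f (ep v u s)) (elen u v - t) (- m)"
      proof (rule right_slopeI)
        show "0 < t - a" using t by simp
        show "f (ep v u s) = f (ep v u (elen u v - t)) + of_int (- m) * (s - (elen u v - t))"
          if "elen u v - t \<le> s" "s \<le> elen u v - t + (t - a)" for s
          using *[of "elen u v - s"] *[of t] t that by (simp add: algebra_simps g_def ep_swap[OF uv])
      qed
    qed
    ultimately show ?thesis by (intro exI[of _ "of_int m"]) auto
  qed
  then show ?thesis using B(1) by (intro exI[of _ B]) blast
qed

end

section \<open>Divisors and their degrees\<close>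

lemma degree_superset:
  assumes "finite P" "Poly_Mapping.keys D \<subseteq> P"
  shows "divisor_degree D = (\<Sum>p\<in>P. Poly_Mapping.lookup D p)"
  unfolding divisor_degree_def
  by (rule sum.mono_neutral_left) (use assms in \<open>auto simp: in_keys_iff\<close>)

lemma degree_add: "divisor_degree (D + E) = divisor_degree D + divisor_degree E"
proof -
  let ?P = "Poly_Mapping.keys D \<union> Poly_Mapping.keys E"
  have "divisor_degree (D + E) = (\<Sum>p\<in>?P. Poly_Mapping.lookup (D + E) p)"
    by (rule degree_superset) (auto dest: set_mp[OF Poly_Mapping.keys_add])
  also have "\<dots> = (\<Sum>p\<in>?P. Poly_Mapping.lookup D p) + (\<Sum>p\<in>?P. Poly_Mapping.lookup E p)"
    by (simp add: lookup_add sum.distrib)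
  also have "\<dots> = divisor_degree D + divisor_degree E"
    by (subst (1 2) degree_superset[of ?P, symmetric]) auto
  finally show ?thesis .
qed

lemma degree_single: "divisor_degree (Poly_Mapping.single p n) = n"
  by (subst degree_superset[of "{p}"]) (auto simp: lookup_single)

lemma degree_zero: "divisor_degree 0 = 0"
  by (simp add: divisor_degree_def)

lemma degree_diff: "divisor_degree (D - E) = divisor_degree D - divisor_degree E"
  using degree_add[of "D - E" E] by simp

lemma degree_sum: "divisor_degree (\<Sum>i\<in>A. f i) = (\<Sum>i\<in>A. divisor_degree (f i))"
  by (induction A rule: infinite_finite_induct) (auto simp: degree_zero degree_add)

lemma lookup_sum_divisor: "Poly_Mapping.lookup (\<Sum>i\<in>A. f i) p = (\<Sum>i\<in>A. Poly_Mapping.lookup (f i) p)"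
  by (induction A rule: infinite_finite_induct) (auto simp: lookup_add)

lemma degree_nonneg: "effective_divisor E \<Longrightarrow> 0 \<le> divisor_degree E"
  unfolding effective_divisor_def divisor_degree_def by (rule sum_nonneg) auto

lemma sum_le_degree:
  assumes "effective_divisor E" "finite X"
  shows "(\<Sum>p\<in>X. Poly_Mapping.lookup E p) \<le> divisor_degree E"
proof -
  have "(\<Sum>p\<in>X. Poly_Mapping.lookup E p) \<le> (\<Sum>p\<in>X \<union> Poly_Mapping.keys E. Poly_Mapping.lookup E p)"
    by (rule sum_mono2) (use assms in \<open>auto simp: effective_divisor_def\<close>)
  also have "\<dots> = divisor_degree E" using assms by (subst degree_superset) auto
  finally show ?thesis .
qed

lemma effective_degree_zero:
  assumes "effective_divisor E" "divisor_degree E = 0"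
  shows "E = 0"
proof (rule poly_mapping_eqI)
  fix p
  show "Poly_Mapping.lookup E p = Poly_Mapping.lookup 0 p"
    using sum_le_degree[OF assms(1), of "{p}"] assms unfolding effective_divisor_def
    by (auto intro: antisym)
qed

lemma effective_add: "effective_divisor D \<Longrightarrow> effective_divisor E \<Longrightarrow> effective_divisor (D + E)"
  by (auto simp: effective_divisor_def lookup_add)

lemma effective_single: "0 \<le> n \<Longrightarrow> effective_divisor (Poly_Mapping.single p n)"
  by (auto simp: effective_divisor_def lookup_single when_def)

lemma effective_sum: "(\<And>i. i \<in> A \<Longrightarrow> effective_divisor (f i)) \<Longrightarrow> effective_divisor (\<Sum>i\<in>A. f i)"
  unfolding effective_divisor_def lookup_sum_divisor by (auto intro: sum_nonneg)

lemma effective_minus_single: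
  assumes "effective_divisor E" "1 \<le> Poly_Mapping.lookup E p"
  shows "effective_divisor (E - Poly_Mapping.single p 1)"
  using assms by (auto simp: effective_divisor_def lookup_minus lookup_single when_def)

lemma effective_degree_one:
  assumes "effective_divisor E" "divisor_degree E = 1"
  shows "\<exists>p. E = Poly_Mapping.single p 1"
proof -
  have "E \<noteq> 0" using assms(2) by (auto simp: degree_zero)
  then obtain p where "Poly_Mapping.lookup E p \<noteq> 0" by (metis lookup_not_eq_zero_eq_in_keys keys_eq_empty equals0I)
  moreover have "0 \<le> Poly_Mapping.lookup E p" using assms(1) by (simp add: effective_divisor_def)
  ultimately have "effective_divisor (E - Poly_Mapping.single p 1)"
    by (intro effective_minus_single assms(1)) linarith
  moreover have "divisor_degree (E - Poly_Mapping.single p 1) = 0"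
    using assms(2) by (simp add: degree_diff degree_single)
  ultimately have "E - Poly_Mapping.single p 1 = 0" by (rule effective_degree_zero)
  then show ?thesis by (intro exI[of _ p]) simp
qed

context finite_metric_graph
begin

lemma divisors_lookup: "D \<in> divisors G \<longleftrightarrow> (\<forall>p. p \<notin> points G \<longrightarrow> Poly_Mapping.lookup D p = 0)"
  unfolding divisors_def by (auto simp: in_keys_iff subset_iff)

lemma divisors_add: "D \<in> divisors G \<Longrightarrow> E \<in> divisors G \<Longrightarrow> D + E \<in> divisors G"
  by (auto simp: divisors_lookup lookup_add)

lemma divisors_diff: "D \<in> divisors G \<Longrightarrow> E \<in> divisors G \<Longrightarrow> D - E \<in> divisors G"
  by (auto simp: divisors_lookup lookup_minus)

lemma divisors_uminus: "D \<in> divisors G \<Longrightarrow> - D \<in> divisors G"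
  by (auto simp: divisors_lookup)

lemma divisors_zero: "0 \<in> divisors G"
  by (auto simp: divisors_lookup)

lemma divisors_single: "p \<in> points G \<Longrightarrow> Poly_Mapping.single p n \<in> divisors G"
  by (auto simp: divisors_lookup lookup_single when_def)

lemma divisors_sum: "(\<And>i. i \<in> A \<Longrightarrow> f i \<in> divisors G) \<Longrightarrow> (\<Sum>i\<in>A. f i) \<in> divisors G"
  by (auto simp: divisors_lookup lookup_sum_divisor)

lemma div_coeff_add:
  assumes "pl f" "pl g"
  shows "div_coeff G (\<lambda>p. f p + g p) q = div_coeff G f q + div_coeff G g q"
  unfolding div_coeff_def sum.distrib[symmetric]
proof (rule sum.cong[OF refl])
  fix \<tau> assume \<tau>: "\<tau> \<in> directions G q"
  obtain u v t m where 1: "\<tau> = (u, v, t)" "right_slope (\<lambda>s. f (ep u v s)) t m"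
      "outgoing_slope G f \<tau> = of_int m" "adj u v" "0 \<le> t" "t < elen u v"
    using pl_directions[OF assms(1) \<tau>] by blast
  obtain n where 2: "right_slope (\<lambda>s. g (ep u v s)) t n" using plD[OF assms(2)] 1 by blast
  show "outgoing_slope G (\<lambda>p. f p + g p) \<tau> = outgoing_slope G f \<tau> + outgoing_slope G g \<tau>"
    using outgoing_slope_eq[OF right_slope_add[OF 1(2) 2]] outgoing_slope_eq[OF 2] 1 by simp
qed

lemma div_coeff_uminus:
  assumes "pl f"
  shows "div_coeff G (\<lambda>p. - f p) q = - div_coeff G f q"
  unfolding div_coeff_def sum_negf[symmetric]
proof (rule sum.cong[OF refl])
  fix \<tau> assume \<tau>: "\<tau> \<in> directions G q"
  obtain u v t m where 1: "\<tau> = (u, v, t)" "right_slope (\<lambda>s. f (ep u v s)) t m"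
      "outgoing_slope G f \<tau> = of_int m"
    using pl_directions[OF assms(1) \<tau>] by blast
  show "outgoing_slope G (\<lambda>p. - f p) \<tau> = - outgoing_slope G f \<tau>"
    using outgoing_slope_eq[OF right_slope_uminus[OF 1(2)]] 1 by simp
qed

lemma div_coeff_int: "pl f \<Longrightarrow> div_coeff G f q \<in> \<int>"
  unfolding div_coeff_def using pl_directions by (intro Ints_sum) (metis Ints_of_int)

lemma div_coeff_interior:
  assumes "adj u v" "0 < t" "t < elen u v"
  shows "div_coeff G f (ep u v t) = outgoing_slope G f (u, v, t) + outgoing_slope G f (v, u, elen u v - t)"
  unfolding div_coeff_def directions_interior[OF assms] using adj_neq[OF assms(1)] by simp

lemma finite_kinks:
  assumes "pl f" "adj u v"
  shows "finite {t. 0 < t \<and> t < elen u v \<and> div_coeff G f (ep u v t) \<noteq> 0}"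
proof -
  obtain B where B: "finite B" "\<And>a b. 0 \<le> a \<and> a < b \<and> b \<le> elen u v \<and> {a<..<b} \<inter> B = {} \<Longrightarrow>
     \<exists>m. (\<forall>t\<in>{a..<b}. outgoing_slope G f (u, v, t) = m) \<and>
          (\<forall>t\<in>{a<..b}. outgoing_slope G f (v, u, elen u v - t) = - m)"
    using pl_pieces[OF assms] by (elim exE conjE) simp
  have "t \<in> B" if t: "0 < t" "t < elen u v" "div_coeff G f (ep u v t) \<noteq> 0" for t
  proof (rule ccontr)
    assume "t \<notin> B"
    have "open (- B)" using finite_imp_closed[OF B(1)] by (simp add: open_Compl)
    then obtain e where e: "0 < e" "ball t e \<subseteq> - B" using \<open>t \<notin> B\<close> by (auto simp: open_contains_ball)
    define a b where "a = max 0 (t - e)" and "b = min (elen u v) (t + e)"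
    have "{a<..<b} \<subseteq> ball t e" by (auto simp: a_def b_def dist_real_def)
    then have "{a<..<b} \<inter> B = {}" using e(2) by blast
    moreover have "0 \<le> a" "a < t" "t < b" "b \<le> elen u v" using t e(1) by (auto simp: a_def b_def)
    ultimately show False
      using B(2)[of a b] t(3) unfolding div_coeff_interior[OF assms(2) t(1,2)] by force
  qed
  then show ?thesis by (intro finite_subset[OF _ B(1)]) blast
qed

lemma finite_div_support:
  assumes f: "pl f"
  shows "finite {p \<in> points G. div_coeff G f p \<noteq> 0}"
proof (rule finite_subset)
  show "{p \<in> points G. div_coeff G f p \<noteq> 0} \<subseteq> vertex_point ` verts G \<union>
      (\<Union>(u, v)\<in>arcs. ep u v ` {t. 0 < t \<and> t < elen u v \<and> div_coeff G f (ep u v t) \<noteq> 0})"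
  proof
    fix p assume p: "p \<in> {p \<in> points G. div_coeff G f p \<noteq> 0}"
    then have "p \<in> points G" by blast
    then show "p \<in> vertex_point ` verts G \<union>
      (\<Union>(u, v)\<in>arcs. ep u v ` {t. 0 < t \<and> t < elen u v \<and> div_coeff G f (ep u v t) \<noteq> 0})"
    proof (cases rule: points_cases)
      case (vertex u)
      then show ?thesis by blast
    next
      case (interior u v t)
      then have "(u, v) \<in> arcs" "p \<in> ep u v ` {t. 0 < t \<and> t < elen u v \<and> div_coeff G f (ep u v t) \<noteq> 0}"
        using p by (auto simp: arcs_def)
      then show ?thesis by blast
    qed
  qed
  show "finite (vertex_point ` verts G \<union>
      (\<Union>(u, v)\<in>arcs. ep u v ` {t. 0 < t \<and> t < elen u v \<and> div_coeff G f (ep u v t) \<noteq> 0}))"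
    using finite_kinks[OF f] finite_arcs finite_verts by (auto simp: arcs_def)
qed

lemma div_exists:
  assumes f: "pl f"
  shows "\<exists>D. is_div_of G D f"
proof -
  define c where "c p = (if p \<in> points G then \<lfloor>div_coeff G f p\<rfloor> else 0)" for p
  have "{p. c p \<noteq> 0} \<subseteq> {p \<in> points G. div_coeff G f p \<noteq> 0}" by (auto simp: c_def)
  then have "finite {p. c p \<noteq> 0}" using finite_div_support[OF f] finite_subset by blast
  then have "Poly_Mapping.lookup (Abs_poly_mapping c) = c" by (rule lookup_Abs_poly_mapping)
  then have "is_div_of G (Abs_poly_mapping c) f"
    unfolding is_div_of_def divisors_lookup using div_coeff_int[OF f]
    by (auto simp: c_def elim!: Ints_cases)
  then show ?thesis by blast
qed

lemma is_div_of_add: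
  "is_div_of G D f \<Longrightarrow> is_div_of G E g \<Longrightarrow> pl f \<Longrightarrow> pl g \<Longrightarrow> is_div_of G (D + E) (\<lambda>p. f p + g p)"
  unfolding is_div_of_def by (simp add: divisors_add lookup_add div_coeff_add)

lemma is_div_of_uminus: "is_div_of G D f \<Longrightarrow> pl f \<Longrightarrow> is_div_of G (- D) (\<lambda>p. - f p)"
  unfolding is_div_of_def by (simp add: divisors_uminus div_coeff_uminus)

text \<open>The divisors of rational functions.\<close>

definition principal :: "'v divisor \<Rightarrow> bool" where
  "principal D \<longleftrightarrow> (\<exists>f. pl f \<and> is_div_of G D f)"

lemma linearly_equivalent_iff: "linearly_equivalent G D E \<longleftrightarrow> principal (D - E)"
  unfolding linearly_equivalent_def principal_def rational_iff_pl ..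

lemma principal_add: "principal D \<Longrightarrow> principal E \<Longrightarrow> principal (D + E)"
  unfolding principal_def using is_div_of_add pl_add by blast

lemma principal_uminus: "principal D \<Longrightarrow> principal (- D)"
  unfolding principal_def using is_div_of_uminus pl_uminus by blast

lemma principal_zero: "principal 0"
proof -
  have rs: "right_slope (\<lambda>s. 0) t 0" for t by (rule right_slopeI[of 1]) auto
  have "outgoing_slope G (\<lambda>p. 0) \<tau> = 0" for \<tau>
    using outgoing_slope_eq[of "\<lambda>p. 0", OF rs] by (cases \<tau>) simp
  then have "is_div_of G 0 (\<lambda>p. 0)" by (simp add: is_div_of_def divisors_zero div_coeff_def)
  moreover have "pl (\<lambda>p. 0)" unfolding pl_def using rs by blast
  ultimately show ?thesis unfolding principal_def by blast
qed

text \<open>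
  The slopes of the two orientations of an edge cancel, if summed over all points where \<open>f\<close> has a kink.
\<close>

lemma sum_slopes_arc:
  assumes f: "pl f" and uv: "adj u v"
    and T: "finite T" "T \<subseteq> {0<..<elen u v}"
      "{t. 0 < t \<and> t < elen u v \<and> div_coeff G f (ep u v t) \<noteq> 0} \<subseteq> T"
  shows "(\<Sum>t\<in>insert 0 T. outgoing_slope G f (u, v, t)) +
         (\<Sum>t\<in>insert 0 ((\<lambda>t. elen u v - t) ` T). outgoing_slope G f (v, u, t)) = 0"
proof -
  define R S where "R t = outgoing_slope G f (u, v, t)"
    and "S t = outgoing_slope G f (v, u, elen u v - t)" for t
  obtain B where B: "finite B" "\<And>a b. 0 \<le> a \<and> a < b \<and> b \<le> elen u v \<and> {a<..<b} \<inter> B = {} \<Longrightarrow>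
     \<exists>m. (\<forall>t\<in>{a..<b}. R t = m) \<and> (\<forall>t\<in>{a<..b}. S t = - m)"
    using pl_pieces[OF assms(1,2)] unfolding R_def S_def by (elim exE conjE) simp
  define T' where "T' = T \<union> (B \<inter> {0<..<elen u v})"
  have "R 0 + (\<Sum>t\<in>T'. R t + S t) + S (elen u v) = 0"
    by (rule sum_slopes_interval[where l = 0 and r = "elen u v" and B = B])
      (use B T elen_pos[OF uv] in \<open>auto simp: T'_def\<close>)
  moreover have "(\<Sum>t\<in>T'. R t + S t) = (\<Sum>t\<in>T. R t + S t)"
  proof (rule sum.mono_neutral_right)
    show "finite T'" "T \<subseteq> T'" using B(1) T(1) by (auto simp: T'_def)
    show "\<forall>t\<in>T' - T. R t + S t = 0"
    proof
      fix t assume t: "t \<in> T' - T"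
      then have "0 < t" "t < elen u v" by (auto simp: T'_def)
      then show "R t + S t = 0"
        using T(3) t div_coeff_interior[OF uv, of t f] unfolding R_def S_def by auto
    qed
  qed
  moreover have "(\<Sum>t\<in>insert 0 T. outgoing_slope G f (u, v, t)) = R 0 + (\<Sum>t\<in>T. R t)"
    using T by (subst sum.insert) (auto simp: R_def)
  moreover have "(\<Sum>t\<in>insert 0 ((\<lambda>t. elen u v - t) ` T). outgoing_slope G f (v, u, t)) =
      S (elen u v) + (\<Sum>t\<in>T. S t)"
    using T by (subst sum.insert) (auto simp: S_def sum.reindex inj_on_def)
  ultimately show ?thesis by (simp add: sum.distrib)
qed

text \<open>
  The sum over the points of the support is rearranged into one over the oriented edges.
\<close>

theorem degree_principal:
  assumes "principal D"
  shows "divisor_degree D = 0"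
proof -
  obtain f where f: "pl f" "is_div_of G D f" using assms unfolding principal_def by blast
  define P where "P = vertex_point ` verts G \<union> {p \<in> points G. div_coeff G f p \<noteq> 0}"
  define T where "T u v = {t. 0 < t \<and> t < elen u v \<and> div_coeff G f (ep u v t) \<noteq> 0}" for u v
  define \<sigma> where "\<sigma> u v = (\<Sum>t\<in>insert 0 (T u v). outgoing_slope G f (u, v, t))" for u v
  have finT: "finite (T u v)" if "adj u v" for u v unfolding T_def by (rule finite_kinks[OF f(1) that])
  have finP: "finite P" unfolding P_def using finite_verts finite_div_support[OF f(1)] by blast
  have PG: "P \<subseteq> points G" using vertex_points by (auto simp: P_def)
  have "Poly_Mapping.keys D \<subseteq> P"
    using f(2) unfolding is_div_of_def divisors_def P_def by (fastforce simp: in_keys_iff)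
  then have "real_of_int (divisor_degree D) = (\<Sum>p\<in>P. div_coeff G f p)"
    using degree_superset[OF finP] f(2) PG unfolding is_div_of_def by (auto intro!: sum.cong)
  also have "\<dots> = (\<Sum>\<tau>\<in>(\<Union>p\<in>P. directions G p). outgoing_slope G f \<tau>)"
    unfolding div_coeff_def
    by (rule sum.UNION_disjoint[symmetric])
      (use finP PG finite_directions in \<open>auto simp: directions_def\<close>)
  also have "\<dots> = (\<Sum>(a, t)\<in>(SIGMA a:arcs. insert 0 (T (fst a) (snd a))).
                    outgoing_slope G f (fst a, snd a, t))"
  proof (rule sum.reindex_bij_witness[where i = "\<lambda>(a, t). (fst a, snd a, t)"
          and j = "\<lambda>(u, v, t). ((u, v), t)"])
    fix \<tau> assume "\<tau> \<in> (\<Union>p\<in>P. directions G p)"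
    then obtain p u v t where \<tau>: "\<tau> = (u, v, t)" "p \<in> P" "adj u v" "0 \<le> t" "t < elen u v" "p = ep u v t"
      by (auto simp: directions_def)
    have "t \<in> insert 0 (T u v)"
    proof (cases "t = 0")
      case False
      then have "p \<notin> vertex_point ` verts G" using \<tau> ep_eq_vertex[of u v t] by auto
      then show ?thesis using \<tau> False unfolding P_def T_def by auto
    qed simp
    then show "(case \<tau> of (u, v, t) \<Rightarrow> ((u, v), t)) \<in> (SIGMA a:arcs. insert 0 (T (fst a) (snd a)))"
      using \<tau> by (auto simp: arcs_def)
  next
    fix x assume "x \<in> (SIGMA a:arcs. insert 0 (T (fst a) (snd a)))"
    then obtain u v t where x: "x = ((u, v), t)" "adj u v" "t \<in> insert 0 (T u v)"
      by (auto simp: arcs_def)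
    have "ep u v t \<in> P"
      using x adj_verts[OF x(2)] ep_0[of u v] ep_points[OF x(2), of t] by (auto simp: P_def T_def)
    moreover have "(u, v, t) \<in> directions G (ep u v t)"
      using x elen_pos[OF x(2)] by (intro directionsI) (auto simp: T_def)
    ultimately show "(case x of (a, t) \<Rightarrow> (fst a, snd a, t)) \<in> (\<Union>p\<in>P. directions G p)"
      using x by auto
  qed auto
  also have "\<dots> = (\<Sum>a\<in>arcs. \<sigma> (fst a) (snd a))"
    unfolding \<sigma>_def by (rule sum.Sigma[symmetric]) (use finite_arcs finT in \<open>auto simp: arcs_def\<close>)
  finally have 1: "real_of_int (divisor_degree D) = (\<Sum>a\<in>arcs. \<sigma> (fst a) (snd a))" .
  also have "\<dots> = (\<Sum>a\<in>arcs. \<sigma> (snd a) (fst a))"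
    by (rule sum.reindex_bij_witness[where i = prod.swap and j = prod.swap])
      (auto simp: arcs_def adj_sym)
  \<comment> \<open>Averaging over the two orientations makes the slopes of each edge meet.\<close>
  finally have "2 * real_of_int (divisor_degree D) =
      (\<Sum>a\<in>arcs. \<sigma> (fst a) (snd a) + \<sigma> (snd a) (fst a))"
    using 1 by (simp add: sum.distrib)
  also have "\<dots> = 0"
  proof (rule sum.neutral, rule ballI)
    fix a assume "a \<in> arcs"
    then obtain u v where a: "a = (u, v)" "adj u v" by (auto simp: arcs_def)
    have "T v u = (\<lambda>t. elen u v - t) ` T u v"
    proof (intro set_eqI iffI)
      fix t assume "t \<in> T v u"
      then show "t \<in> (\<lambda>t. elen u v - t) ` T u v"
        by (intro image_eqI[of _ _ "elen u v - t"]) (auto simp: T_def ep_swap[OF a(2)] elen_sym[of v u])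
    next
      fix t assume "t \<in> (\<lambda>t. elen u v - t) ` T u v"
      then show "t \<in> T v u" by (auto simp: T_def ep_swap[OF a(2)] elen_sym[of v u])
    qed
    moreover have "T u v \<subseteq> {0<..<elen u v}" by (auto simp: T_def)
    ultimately have "\<sigma> u v + \<sigma> v u = 0"
      unfolding \<sigma>_def using sum_slopes_arc[OF f(1) a(2) finT[OF a(2)]] by (simp add: T_def)
    then show "\<sigma> (fst a) (snd a) + \<sigma> (snd a) (fst a) = 0" using a by simp
  qed
  finally show ?thesis by simp
qed

end

section \<open>Truncations and cliques\<close>

context finite_metric_graph
begin

lemma max_slope:
  assumes "pl f" "\<tau> \<in> directions G p"
  shows "outgoing_slope G (\<lambda>q. max (f q) c) \<tau> =
    (if c < f p then outgoing_slope G f \<tau> else if f p = c then max (outgoing_slope G f \<tau>) 0 else 0)"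
proof -
  obtain u v t m where 1: "\<tau> = (u, v, t)" "p = ep u v t" "right_slope (\<lambda>s. f (ep u v s)) t m"
      "outgoing_slope G f \<tau> = of_int m"
    using pl_directions[OF assms] by blast
  show ?thesis
    using outgoing_slope_eq[OF right_slope_max[OF 1(3), of c]] 1 by (simp add: of_int_max)
qed

lemma div_max_nonneg: "pl f \<Longrightarrow> f p \<le> c \<Longrightarrow> 0 \<le> div_coeff G (\<lambda>q. max (f q) c) p"
  unfolding div_coeff_def by (intro sum_nonneg) (simp add: max_slope)

lemma div_max_above: "pl f \<Longrightarrow> c < f p \<Longrightarrow> div_coeff G (\<lambda>q. max (f q) c) p = div_coeff G f p"
  unfolding div_coeff_def by (intro sum.cong) (simp_all add: max_slope)

lemma div_max_level: "pl f \<Longrightarrow> f p = c \<Longrightarrow> div_coeff G f p \<le> div_coeff G (\<lambda>q. max (f q) c) p"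
  unfolding div_coeff_def by (intro sum_mono) (simp_all add: max_slope)

lemma lookup_div: "is_div_of G D f \<Longrightarrow> p \<in> points G \<Longrightarrow> of_int (Poly_Mapping.lookup D p) = div_coeff G f p"
  unfolding is_div_of_def by blast

text \<open>
  Truncation keeps effectivity: where \<open>f > c\<close>, the new divisor agrees with \<open>E + D\<close>, and elsewhere the slopes
  of the truncated function are nonnegative, so that no chips of \<open>E\<close> are removed.
\<close>

lemma effective_truncation:
  assumes "pl f" "is_div_of G D f" "is_div_of G D1 (\<lambda>q. max (f q) c)"
    and "effective_divisor E" "effective_divisor (E + D)"
  shows "effective_divisor (E + D1)"
  unfolding effective_divisor_def
proof
  fix p
  show "0 \<le> Poly_Mapping.lookup (E + D1) p"
  proof (cases "p \<in> points G")
    case False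
    then show ?thesis
      using assms unfolding is_div_of_def divisors_lookup effective_divisor_def by (simp add: lookup_add)
  next
    case p: True
    show ?thesis
    proof (cases "f p \<le> c")
      case True
      have "(0::real) \<le> of_int (Poly_Mapping.lookup D1 p)"
        using div_max_nonneg[OF assms(1) True] lookup_div[OF assms(3) p] by simp
      then show ?thesis using assms(4) unfolding effective_divisor_def by (simp add: lookup_add)
    next
      case False
      then have "real_of_int (Poly_Mapping.lookup D1 p) = of_int (Poly_Mapping.lookup D p)"
        using div_max_above[OF assms(1)] lookup_div[OF assms(3) p] lookup_div[OF assms(2) p] by simp
      then show ?thesis using assms(5) unfolding effective_divisor_def by (simp add: lookup_add)
    qed
  qed
qed

lemma slope_at_maximum:
  assumes "pl h" "\<And>q. h q \<le> 0" "h p = 0" "\<tau> \<in> directions G p"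
  shows "outgoing_slope G h \<tau> \<le> 0"
proof -
  obtain u v t m where 1: "p = ep u v t" "right_slope (\<lambda>s. h (ep u v s)) t m"
      "outgoing_slope G h \<tau> = of_int m"
    using pl_directions[OF assms(1,4)] by blast
  obtain e where e: "0 < e" "\<And>s. t \<le> s \<Longrightarrow> s \<le> t + e \<Longrightarrow>
      h (ep u v s) = h (ep u v t) + of_int m * (s - t)"
    by (rule right_slopeE[OF 1(2)], rule that)
  have "h (ep u v (t + e)) = of_int m * e" using e(2)[of "t + e"] e(1) 1(1) assms(3) by simp
  then have "of_int m * e \<le> 0" using assms(2) by metis
  then show ?thesis using e(1) 1(3) by (simp add: mult_le_0_iff)
qed

text \<open>
  The direction is taken at the last point of the edge at which \<open>h\<close> vanishes.
\<close>

lemma descending_direction: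
  assumes "pl h" "adj u v" "\<And>q. h q \<le> 0" "h (vertex_point u) = 0" "h (vertex_point v) < 0"
  shows "\<exists>t. 0 \<le> t \<and> t < elen u v \<and> h (ep u v t) = 0 \<and> outgoing_slope G h (u, v, t) \<le> - 1"
proof -
  define Z where "Z = {t \<in> {0..elen u v}. h (ep u v t) = 0}"
  have "closed Z"
    unfolding Z_def by (intro continuous_closed_preimage_constant pl_continuous assms) auto
  moreover have "bounded Z" unfolding Z_def by (rule bounded_subset[of "{0..elen u v}"]) auto
  ultimately have "compact Z" by (simp add: compact_eq_bounded_closed)
  moreover have "0 \<in> Z" using assms(4) elen_pos[OF assms(2)] by (simp add: Z_def ep_0)
  ultimately obtain t where t: "t \<in> Z" "\<And>s. s \<in> Z \<Longrightarrow> s \<le> t"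
    using compact_attains_sup[of Z] by blast
  have "t \<noteq> elen u v" using t(1) assms(5) ep_elen[OF assms(2)] by (auto simp: Z_def)
  then have t': "0 \<le> t" "t < elen u v" "h (ep u v t) = 0" using t(1) by (auto simp: Z_def)
  obtain m where m: "right_slope (\<lambda>s. h (ep u v s)) t m" using plD[OF assms(1,2) t'(1,2)] by blast
  obtain e where e: "0 < e" "\<And>s. t \<le> s \<Longrightarrow> s \<le> t + e \<Longrightarrow>
      h (ep u v s) = h (ep u v t) + of_int m * (s - t)"
    by (rule right_slopeE[OF m], rule that)
  define s where "s = min (t + e) (elen u v)"
  have s: "t < s" "s \<le> t + e" "s \<le> elen u v" using e(1) t' by (auto simp: s_def)
  then have "s \<notin> Z" using t(2) by force
  then have "h (ep u v s) \<noteq> 0" using s t' by (simp add: Z_def)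
  then have "of_int m * (s - t) < 0"
    using e(2)[of s] s t'(3) assms(3)[of "ep u v s"] by (simp add: less_le)
  then have "m \<le> - 1" using s(1) by (simp add: mult_less_0_iff)
  then show ?thesis using t' outgoing_slope_eq[OF m] by (intro exI[of _ t]) auto
qed

text \<open>
  A set of \<open>j\<close> vertices of a clique with \<open>m\<close> elements, \<open>0 < j < m\<close>, is joined to the rest of the clique by
  \<open>j * (m - j) \<ge> m - 1\<close> edges, so that fewer than \<open>m - 1\<close> chips do not suffice to fire across all of them.
\<close>

lemma constant_on_clique:
  assumes M: "M \<subseteq> verts G" "\<And>u v. u \<in> M \<Longrightarrow> v \<in> M \<Longrightarrow> u \<noteq> v \<Longrightarrow> adj u v"
    and f: "pl f" "is_div_of G D f"
    and E: "effective_divisor E" "effective_divisor (E + D)"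
    and deg: "divisor_degree E < int (card M) - 1"
    and uv: "u \<in> M" "v \<in> M"
  shows "f (vertex_point u) = f (vertex_point v)"
proof -
  have fin: "finite M" using M(1) finite_verts finite_subset by blast
  define c where "c = Max ((\<lambda>u. f (vertex_point u)) ` M)"
  define A where "A = {u \<in> M. f (vertex_point u) = c}"
  define B where "B = {u \<in> M. f (vertex_point u) < c}"
  have le: "f (vertex_point w) \<le> c" if "w \<in> M" for w using fin that by (simp add: c_def)
  then have AB: "A \<union> B = M" "A \<inter> B = {}" unfolding A_def B_def by force+
  have "c \<in> (\<lambda>u. f (vertex_point u)) ` M" unfolding c_def by (rule Max_in) (use fin uv in auto)
  then have "A \<noteq> {}" by (auto simp: A_def)
  have finAB: "finite A" "finite B" using fin AB by auto
  have "B = {}"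
  proof (rule ccontr)
    assume "B \<noteq> {}"
    have 1: "pl (\<lambda>q. max (f q) c)" by (rule pl_max[OF f(1)])
    obtain D1 where D1: "is_div_of G D1 (\<lambda>q. max (f q) c)" using div_exists[OF 1] by blast
    \<comment> \<open>\<open>h\<close> is \<open>min (f - c) 0\<close>; it leads from \<open>E + D1\<close> to \<open>E + D\<close>.\<close>
    define h where "h = (\<lambda>q. f q + - max (f q) c)"
    have h: "pl h" "is_div_of G (D + - D1) h"
      unfolding h_def using pl_add[OF f(1) pl_uminus[OF 1]]
        is_div_of_add[OF f(2) is_div_of_uminus[OF D1 1] f(1) pl_uminus[OF 1]] by blast+
    have h0: "h q \<le> 0" for q by (simp add: h_def)
    have eff: "effective_divisor (E + D1)" by (rule effective_truncation[OF f D1 E])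
    have "principal D1" using 1 D1 unfolding principal_def by blast
    then have degE1: "divisor_degree (E + D1) = divisor_degree E"
      by (simp add: degree_add degree_principal)
    have adjAB: "adj a b" if "a \<in> A" "b \<in> B" for a b
      using that M(2)[of a b] unfolding A_def B_def by auto
    have "\<forall>a\<in>A. \<forall>b\<in>B. \<exists>t. 0 \<le> t \<and> t < elen a b \<and> h (ep a b t) = 0 \<and> outgoing_slope G h (a, b, t) \<le> - 1"
      using descending_direction[OF h(1) adjAB h0] by (simp add: A_def B_def h_def)
    then obtain t where t: "\<And>a b. a \<in> A \<Longrightarrow> b \<in> B \<Longrightarrow> 0 \<le> t a b \<and> t a b < elen a b \<and>
        h (ep a b (t a b)) = 0 \<and> outgoing_slope G h (a, b, t a b) \<le> - 1"
      by metis
    define x where "x = (\<lambda>(a, b). ep a b (t a b))"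
    define X where "X = x ` (A \<times> B)"
    \<comment> \<open>Each edge between \<open>A\<close> and \<open>B\<close> takes a chip of \<open>E + D1\<close> at the point where \<open>h\<close> starts to descend.\<close>
    have "int (card {e \<in> A \<times> B. x e = p}) \<le> Poly_Mapping.lookup (E + D1) p" if "p \<in> X" for p
    proof -
      obtain a b where ab: "a \<in> A" "b \<in> B" "p = ep a b (t a b)"
        using \<open>p \<in> X\<close> unfolding X_def x_def by auto
      then have p: "p \<in> points G" "h p = 0"
        using t[of a b] adjAB[of a b] ep_points[of a b "t a b"] by simp_all
      define Y where "Y = (\<lambda>(a, b). (a, b, t a b)) ` {e \<in> A \<times> B. x e = p}"
      have Y: "Y \<subseteq> directions G p"
        using t adjAB unfolding Y_def x_def by (auto intro!: directionsI)
      have cardY: "card Y = card {e \<in> A \<times> B. x e = p}"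
        unfolding Y_def by (rule card_image) (auto simp: inj_on_def)
      have "div_coeff G h p = (\<Sum>\<tau>\<in>directions G p - Y. outgoing_slope G h \<tau>) + (\<Sum>\<tau>\<in>Y. outgoing_slope G h \<tau>)"
        unfolding div_coeff_def by (rule sum.subset_diff[OF Y finite_directions[OF p(1)]])
      also have "\<dots> \<le> 0 + (\<Sum>\<tau>\<in>Y. - 1)"
      proof (rule add_mono)
        show "(\<Sum>\<tau>\<in>directions G p - Y. outgoing_slope G h \<tau>) \<le> 0"
          using slope_at_maximum[OF h(1) h0 p(2)] by (intro sum_nonpos) blast
        show "(\<Sum>\<tau>\<in>Y. outgoing_slope G h \<tau>) \<le> (\<Sum>\<tau>\<in>Y. - 1)"
          using t unfolding Y_def by (intro sum_mono) auto
      qed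
      finally have "real_of_int (Poly_Mapping.lookup (D + - D1) p) \<le> of_int (- int (card Y))"
        using lookup_div[OF h(2) p(1)] by simp
      then have "Poly_Mapping.lookup (D + - D1) p \<le> - int (card Y)"
        by (simp only: of_int_le_iff)
      then have "Poly_Mapping.lookup D p - Poly_Mapping.lookup D1 p \<le> - int (card Y)"
        by (simp add: lookup_minus)
      moreover have "0 \<le> Poly_Mapping.lookup E p + Poly_Mapping.lookup D p"
        using E(2) by (simp add: effective_divisor_def lookup_add)
      ultimately show ?thesis by (simp add: cardY lookup_add)
    qed
    then have "(\<Sum>p\<in>X. int (card {e \<in> A \<times> B. x e = p})) \<le> (\<Sum>p\<in>X. Poly_Mapping.lookup (E + D1) p)"
      by (rule sum_mono)
    also have "\<dots> \<le> divisor_degree (E + D1)"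
      using finAB by (intro sum_le_degree[OF eff]) (auto simp: X_def)
    also have "\<dots> < int (card M) - 1" using degE1 deg by simp
    also have "(\<Sum>p\<in>X. int (card {e \<in> A \<times> B. x e = p})) = int (card A * card B)"
      using sum.image_gen[of "A \<times> B" "\<lambda>_. 1::int" x] finAB by (simp add: X_def card_cartesian_product)
    finally have "int (card A) * int (card B) < int (card A) + int (card B) - 1"
      using card_Un_disjoint[OF finAB AB(2)] AB(1) by simp
    moreover have "1 \<le> int (card A)" "1 \<le> int (card B)"
      using finAB \<open>A \<noteq> {}\<close> \<open>B \<noteq> {}\<close> by (auto simp: Suc_le_eq card_gt_0_iff)
    \<comment> \<open>This is \<open>j * (m - j) \<ge> m - 1\<close> for \<open>j = card A\<close> and \<open>m = card A + card B\<close>.\<close>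
    then have "0 \<le> (int (card A) - 1) * (int (card B) - 1)" by simp
    ultimately show False by (simp add: algebra_simps)
  qed
  then have "u \<in> A" "v \<in> A" using AB uv by auto
  then show ?thesis by (simp add: A_def)
qed

section \<open>Rank and gonality\<close>

text \<open>
  The rank of \<open>D\<close> is at least \<open>r\<close>. This is the condition on \<open>r\<close> that the rank maximizes if the linear system
  is not empty.
\<close>

definition rank_ge :: "'v divisor \<Rightarrow> nat \<Rightarrow> bool" where
  "rank_ge D r \<longleftrightarrow> (\<forall>E\<in>divisors G. effective_divisor E \<and> divisor_degree E = int r \<longrightarrow>
      linear_system G (D - E) \<noteq> {})"

lemma linear_system_iff:
  "F \<in> linear_system G D \<longleftrightarrow> F \<in> divisors G \<and> effective_divisor F \<and> principal (F - D)"
  unfolding linear_system_def linearly_equivalent_iff by blast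

lemma linear_system_add:
  assumes "F \<in> linear_system G (D - E)" "E \<in> divisors G" "effective_divisor E"
  shows "F + E \<in> linear_system G D"
proof -
  have eq: "F - (D - E) = F + E - D" by simp
  show ?thesis
    using assms unfolding linear_system_iff eq by (simp add: divisors_add effective_add)
qed

lemma linear_system_degree: "F \<in> linear_system G D \<Longrightarrow> divisor_degree F = divisor_degree D"
  using degree_principal[of "F - D"] by (simp add: linear_system_iff degree_diff)

lemma rank_ge_degree:
  assumes "rank_ge D r" "p \<in> points G"
  shows "int r \<le> divisor_degree D"
proof -
  let ?E = "Poly_Mapping.single p (int r)"
  have "linear_system G (D - ?E) \<noteq> {}"
    using assms unfolding rank_ge_def by (simp add: divisors_single effective_single degree_single)
  then obtain F where F: "F \<in> linear_system G (D - ?E)" by blast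
  then have "divisor_degree F = divisor_degree D - int r"
    using linear_system_degree degree_diff degree_single by metis
  then show ?thesis using F degree_nonneg[of F] by (simp add: linear_system_iff)
qed

lemma rank_ge_zero: "linear_system G D \<noteq> {} \<Longrightarrow> rank_ge D 0"
  unfolding rank_ge_def using effective_degree_zero by fastforce

lemma rank_ge_one_iff:
  "rank_ge D 1 \<longleftrightarrow> (\<forall>p\<in>points G. \<exists>F\<in>linear_system G D. 1 \<le> Poly_Mapping.lookup F p)"
proof
  assume r: "rank_ge D 1"
  show "\<forall>p\<in>points G. \<exists>F\<in>linear_system G D. 1 \<le> Poly_Mapping.lookup F p"
  proof
    fix p assume p: "p \<in> points G"
    let ?E = "Poly_Mapping.single p (1::int)"
    have E: "?E \<in> divisors G" "effective_divisor ?E" using p by (simp_all add: divisors_single effective_single)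
    then have "linear_system G (D - ?E) \<noteq> {}"
      using r unfolding rank_ge_def by (simp add: degree_single)
    then obtain F where F: "F \<in> linear_system G (D - ?E)" by blast
    then have "F + ?E \<in> linear_system G D" using linear_system_add E by blast
    moreover have "1 \<le> Poly_Mapping.lookup (F + ?E) p"
      using F by (simp add: linear_system_iff effective_divisor_def lookup_add)
    ultimately show "\<exists>F\<in>linear_system G D. 1 \<le> Poly_Mapping.lookup F p" by blast
  qed
next
  assume r: "\<forall>p\<in>points G. \<exists>F\<in>linear_system G D. 1 \<le> Poly_Mapping.lookup F p"
  show "rank_ge D 1"
    unfolding rank_ge_def
  proof (intro ballI impI)
    fix E assume E: "E \<in> divisors G" "effective_divisor E \<and> divisor_degree E = int 1"
    then obtain p where p: "E = Poly_Mapping.single p 1" using effective_degree_one by fastforce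
    then have "p \<in> points G" using E(1) by (simp add: divisors_def)
    then obtain F where F: "F \<in> linear_system G D" "1 \<le> Poly_Mapping.lookup F p" using r by blast
    have "F - E - (D - E) = F - D" by simp
    then have "F - E \<in> linear_system G (D - E)"
      using F E effective_minus_single[of F p] p by (simp add: linear_system_iff divisors_diff)
    then show "linear_system G (D - E) \<noteq> {}" by blast
  qed
qed

lemma rank_ge_shift:
  assumes "rank_ge D (k + 1)" "p \<in> points G"
  shows "rank_ge (D - Poly_Mapping.single p (int k)) 1"
  unfolding rank_ge_def
proof (intro ballI impI)
  fix E assume E: "E \<in> divisors G" "effective_divisor E \<and> divisor_degree E = int 1"
  let ?E = "Poly_Mapping.single p (int k) + E"
  have "?E \<in> divisors G" "effective_divisor ?E" "divisor_degree ?E = int (k + 1)"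
    using E assms(2)
    by (simp_all add: divisors_add divisors_single effective_add effective_single degree_add degree_single)
  then have "linear_system G (D - ?E) \<noteq> {}" using assms(1) unfolding rank_ge_def by blast
  then show "linear_system G (D - Poly_Mapping.single p (int k) - E) \<noteq> {}"
    by (simp add: diff_diff_eq)
qed

lemma divisor_rank_oneD:
  assumes "divisor_rank G D = 1" "p \<in> points G"
  shows "rank_ge D 1"
proof -
  have ne: "linear_system G D \<noteq> {}" and g: "(GREATEST r. rank_ge D r) = 1"
    using assms(1) unfolding divisor_rank_def rank_ge_def by (auto split: if_splits)
  have "r \<le> nat (divisor_degree D)" if "rank_ge D r" for r
    using rank_ge_degree[OF that assms(2)] by simp
  then have "rank_ge D (GREATEST r. rank_ge D r)"
    using GreatestI_nat[of "rank_ge D", OF rank_ge_zero[OF ne]] by blast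
  then show ?thesis by (simp add: g)
qed

lemma divisor_rank_oneI:
  assumes "rank_ge D 1" "p \<in> points G" "\<And>r. rank_ge D r \<Longrightarrow> r \<le> 1"
  shows "divisor_rank G D = 1"
proof -
  have "linear_system G D \<noteq> {}" using assms(1,2) unfolding rank_ge_one_iff by blast
  moreover have "(GREATEST r. rank_ge D r) = 1" by (rule Greatest_equality) (use assms in auto)
  ultimately show ?thesis unfolding divisor_rank_def rank_ge_def by simp
qed

text \<open>
  The extremal argument: an effective divisor equivalent to \<open>D\<close> that hits as many vertices of the clique as
  possible would have to hit all of them.
\<close>

lemma clique_rank_bound:
  assumes M: "M \<subseteq> verts G" "\<And>u v. u \<in> M \<Longrightarrow> v \<in> M \<Longrightarrow> u \<noteq> v \<Longrightarrow> adj u v" "M \<noteq> {}"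
    and r: "rank_ge D 1"
  shows "int (card M) - 1 \<le> divisor_degree D"
proof (rule ccontr)
  assume "\<not> int (card M) - 1 \<le> divisor_degree D"
  then have deg: "divisor_degree D < int (card M) - 1" by simp
  have fin: "finite M" using M(1) finite_verts finite_subset by blast
  \<comment> \<open>the vertices of the clique that carry a chip of \<open>F\<close>\<close>
  define H where "H F = {u \<in> M. 1 \<le> Poly_Mapping.lookup F (vertex_point u)}" for F :: "'v divisor"
  have HM: "H F \<subseteq> M" "finite (H F)" for F using fin by (auto simp: H_def)
  obtain u0 where "u0 \<in> M" using M(3) by blast
  then have "linear_system G D \<noteq> {}"
    using r M(1) vertex_points unfolding rank_ge_one_iff by blast
  then obtain E0 where "E0 \<in> linear_system G D" by blast
  moreover have "\<forall>F. F \<in> linear_system G D \<longrightarrow> card (H F) < card M + 1"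
    using card_mono[OF fin HM(1)] by (simp add: less_Suc_eq_le)
  ultimately obtain E where E: "E \<in> linear_system G D"
      "\<And>F. F \<in> linear_system G D \<Longrightarrow> card (H F) \<le> card (H E)"
    using Lattices_Big.ex_has_greatest_nat[of "\<lambda>F. F \<in> linear_system G D" E0 "\<lambda>F. card (H F)"] by blast
  have "int (card (H E)) \<le> (\<Sum>u\<in>H E. Poly_Mapping.lookup E (vertex_point u))"
    using sum_mono[of "H E" "\<lambda>_. 1" "\<lambda>u. Poly_Mapping.lookup E (vertex_point u)"] by (simp add: H_def)
  also have "\<dots> = (\<Sum>p\<in>vertex_point ` H E. Poly_Mapping.lookup E p)"
    by (subst sum.reindex) (auto simp: inj_on_def vertex_point_inj)
  also have "\<dots> \<le> divisor_degree E"
    using E(1) HM by (intro sum_le_degree) (auto simp: linear_system_iff)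
  finally have "card (H E) < card M" using deg linear_system_degree[OF E(1)] by linarith
  then have "H E \<noteq> M" by auto
  then obtain v where v: "v \<in> M" "v \<notin> H E" using HM by blast
  obtain E' where E': "E' \<in> linear_system G D" "1 \<le> Poly_Mapping.lookup E' (vertex_point v)"
    using r v M(1) vertex_points unfolding rank_ge_one_iff by blast
  have "principal ((E' - D) + - (E - D))"
    using E(1) E'(1) by (intro principal_add principal_uminus) (simp_all add: linear_system_iff)
  then obtain f where f: "pl f" "is_div_of G (E' - E) f" unfolding principal_def by auto
  define c where "c = f (vertex_point v)"
  have const: "f (vertex_point u) = c" if "u \<in> M" for u
    unfolding c_def
    by (rule constant_on_clique[OF M(1,2) f, of E])
      (use E(1) E'(1) deg linear_system_degree[OF E(1)] that v in \<open>auto simp: linear_system_iff\<close>)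
  have 1: "pl (\<lambda>q. max (f q) c)" by (rule pl_max[OF f(1)])
  obtain D1 where D1: "is_div_of G D1 (\<lambda>q. max (f q) c)" using div_exists[OF 1] by blast
  have "effective_divisor (E + D1)"
    by (rule effective_truncation[OF f D1]) (use E(1) E'(1) in \<open>auto simp: linear_system_iff\<close>)
  moreover have "principal D1" using 1 D1 unfolding principal_def by blast
  then have "principal ((E - D) + D1)" using E(1) by (intro principal_add) (auto simp: linear_system_iff)
  then have "principal (E + D1 - D)" by (simp add: algebra_simps)
  ultimately have lin: "E + D1 \<in> linear_system G D"
    using E(1) D1 by (auto simp: linear_system_iff is_div_of_def divisors_add)
  have D1_nonneg: "0 \<le> Poly_Mapping.lookup D1 (vertex_point u)"
    and D1_ge: "Poly_Mapping.lookup (E' - E) (vertex_point u) \<le> Poly_Mapping.lookup D1 (vertex_point u)"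
    if u: "u \<in> M" for u
  proof -
    have p: "vertex_point u \<in> points G" using u M(1) vertex_points by blast
    have "(0::real) \<le> of_int (Poly_Mapping.lookup D1 (vertex_point u))"
      unfolding lookup_div[OF D1 p] using const[OF u] by (intro div_max_nonneg[OF f(1)]) simp
    then show "0 \<le> Poly_Mapping.lookup D1 (vertex_point u)" by simp
    have "real_of_int (Poly_Mapping.lookup (E' - E) (vertex_point u)) \<le> of_int (Poly_Mapping.lookup D1 (vertex_point u))"
      unfolding lookup_div[OF D1 p] lookup_div[OF f(2) p] by (rule div_max_level[OF f(1) const[OF u]])
    then show "Poly_Mapping.lookup (E' - E) (vertex_point u) \<le> Poly_Mapping.lookup D1 (vertex_point u)"
      by simp
  qed
  have "H E \<subseteq> H (E + D1)" using D1_nonneg by (fastforce simp: H_def lookup_add)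
  moreover have "v \<in> H (E + D1)"
    using D1_ge[OF v(1)] E'(2) v(1) by (simp add: H_def lookup_add lookup_minus)
  ultimately have "H E \<subset> H (E + D1)" using v(2) by blast
  then have "card (H E) < card (H (E + D1))" by (rule psubset_card_mono[OF HM(2)])
  then show False using E(2)[OF lin] by simp
qed

theorem gonality_clique:
  assumes M: "M \<subseteq> verts G" "\<And>u v. u \<in> M \<Longrightarrow> v \<in> M \<Longrightarrow> u \<noteq> v \<Longrightarrow> adj u v" "M \<noteq> {}"
    and D: "D \<in> divisors G" "divisor_degree D = int (card M) - 1" "rank_ge D 1"
  shows "gonality G = int (card M) - 1"
  unfolding gonality_def
proof (rule Least_equality)
  obtain u where "u \<in> M" using M(3) by blast
  then have p: "vertex_point u \<in> points G" using M(1) vertex_points by blast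
  have "r \<le> 1" if "rank_ge D r" for r
  proof (rule ccontr)
    assume "\<not> r \<le> 1"
    define k where "k = r - 1"
    have k: "1 \<le> k" "r = k + 1" using \<open>\<not> r \<le> 1\<close> by (auto simp: k_def)
    have "rank_ge (D - Poly_Mapping.single (vertex_point u) (int k)) 1"
      using rank_ge_shift[of D k] that k(2) p by blast
    then show False
      using clique_rank_bound[OF M] D(2) k(1) by (fastforce simp: degree_diff degree_single)
  qed
  then have "divisor_rank G D = 1" by (rule divisor_rank_oneI[OF D(3) p])
  then show "\<exists>D\<in>divisors G. divisor_degree D = int (card M) - 1 \<and> divisor_rank G D = 1"
    using D by blast
  show "int (card M) - 1 \<le> n" if "\<exists>D\<in>divisors G. divisor_degree D = n \<and> divisor_rank G D = 1" for n
    using that divisor_rank_oneD[OF _ p] clique_rank_bound[OF M] by blast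
qed

end

section \<open>Moving chips along edges\<close>

lemma right_slope_const: "right_slope (\<lambda>s. c) t 0"
  by (rule right_slopeI[of 1]) auto

lemma right_slope_sum:
  assumes "\<And>i. i \<in> A \<Longrightarrow> right_slope (g i) t (m i)"
  shows "right_slope (\<lambda>s. \<Sum>i\<in>A. g i s) t (\<Sum>i\<in>A. m i)"
  using assms
  by (induction A rule: infinite_finite_induct) (auto intro: right_slope_const right_slope_add)

text \<open>Zero up to \<open>a\<close>, of slope one between \<open>a\<close> and \<open>b\<close>, and constant thereafter.\<close>

definition ramp :: "real \<Rightarrow> real \<Rightarrow> real \<Rightarrow> real" where
  "ramp a b t = max 0 (min (t - a) (b - a))"

lemma right_slope_ramp:
  assumes "a \<le> b"
  shows "right_slope (\<lambda>s. - ramp a b s) t (if a \<le> t \<and> t < b then - 1 else 0)"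
proof -
  consider "t < a" | "a \<le> t" "t < b" | "b \<le> t" by linarith
  then show ?thesis
  proof cases
    case 1
    then show ?thesis by (intro right_slopeI[of "a - t"]) (auto simp: ramp_def)
  next
    case 2
    then show ?thesis by (intro right_slopeI[of "b - t"]) (auto simp: ramp_def)
  next
    case 3
    then show ?thesis using assms by (intro right_slopeI[of 1]) (auto simp: ramp_def)
  qed
qed

lemma right_slope_ramp_reversed:
  assumes "a \<le> b"
  shows "right_slope (\<lambda>s. b - a - ramp a b (l - s)) t (if a < l - t \<and> l - t \<le> b then 1 else 0)"
proof -
  consider "l - t \<le> a" | "a < l - t" "l - t \<le> b" | "b < l - t" by linarith
  then show ?thesis
  proof cases
    case 1
    then show ?thesis using assms by (intro right_slopeI[of 1]) (auto simp: ramp_def)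
  next
    case 2
    then show ?thesis by (intro right_slopeI[of "l - t - a"]) (auto simp: ramp_def)
  next
    case 3
    then show ?thesis using assms by (intro right_slopeI[of "l - t - b"]) (auto simp: ramp_def)
  qed
qed

context finite_metric_graph
begin

text \<open>
  A function on the graph can be prescribed edge by edge, if the prescriptions for the two orientations
  of an edge agree and the values at a vertex do not depend on the edge.
\<close>

lemma function_on_edges:
  assumes rev: "\<And>x y t. adj x y \<Longrightarrow> F y x t = F x y (elen x y - t)"
    and vert: "\<And>x y. adj x y \<Longrightarrow> F x y 0 = \<phi> x"
  shows "\<exists>f :: 'v point \<Rightarrow> real. \<forall>x y t. adj x y \<and> 0 \<le> t \<and> t \<le> elen x y \<longrightarrow> f (ep x y t) = F x y t"
proof -
  have vert': "F x y (elen x y) = \<phi> y" if "adj x y" for x y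
    using rev[OF that, of 0] vert[OF adj_sym[OF that]] by simp
  have unique: "F x y t = F x' y' t'"
    if 1: "adj x y" "0 \<le> t" "t \<le> elen x y" and 2: "adj x' y'" "0 \<le> t'" "t' \<le> elen x' y'"
      and eq: "ep x y t = ep x' y' t'" for x y t x' y' t'
  proof -
    consider "t = 0" | "t = elen x y" | "0 < t" "t < elen x y" using 1 by linarith
    then show ?thesis
    proof cases
      case 1
      then have "ep x' y' t' = vertex_point x" using eq by (simp add: ep_0)
      then consider "t' = 0" "x = x'" | "t' = elen x' y'" "x = y'" using ep_eq_vertex[OF 2] by blast
      then show ?thesis using 1 vert[OF \<open>adj x y\<close>] vert[OF 2(1)] vert'[OF 2(1)] by cases simp_all
    next
      case 3: 2
      then have "ep x' y' t' = vertex_point y" using eq ep_elen[OF 1(1)] by simp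
      then consider "t' = 0" "y = x'" | "t' = elen x' y'" "y = y'" using ep_eq_vertex[OF 2] by blast
      then show ?thesis using 3 vert'[OF 1(1)] vert[OF 2(1)] vert'[OF 2(1)] by cases simp_all
    next
      case 3
      then consider "x' = x" "y' = y" "t' = t" | "x' = y" "y' = x" "t' = elen x y - t"
        using ep_eq_interior[OF 1(1) 3 2] eq by auto
      then show ?thesis using rev[OF 1(1), of "elen x y - t"] by cases simp_all
    qed
  qed
  define Q where "Q p r \<longleftrightarrow> (\<exists>x y t. adj x y \<and> 0 \<le> t \<and> t \<le> elen x y \<and> ep x y t = p \<and> r = F x y t)" for p r
  define f where "f p = (SOME r. Q p r)" for p
  have "f (ep x y t) = F x y t" if 1: "adj x y" "0 \<le> t" "t \<le> elen x y" for x y t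
  proof -
    have "Q (ep x y t) (F x y t)" unfolding Q_def using 1 by blast
    then have "Q (ep x y t) (f (ep x y t))" unfolding f_def by (rule someI)
    then show ?thesis unfolding Q_def using unique 1 by metis
  qed
  then show ?thesis by blast
qed

text \<open>
  The tuple \<open>(u, v, a, b)\<close> stands for moving a chip along the edge from \<open>u\<close> to \<open>v\<close>, from the point at distance
  \<open>a\<close> from \<open>u\<close> to the one at distance \<open>b\<close>.
\<close>

definition chip_move :: "'v \<times> 'v \<times> real \<times> real \<Rightarrow> bool" where
  "chip_move = (\<lambda>(u, v, a, b). adj u v \<and> 0 \<le> a \<and> a \<le> b \<and> b \<le> elen u v)"

text \<open>
  The change along the oriented edge from \<open>x\<close> to \<open>y\<close>, relative to \<open>x\<close>, of a function whose divisor realizes a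
  chip move: it has slope \<open>-1\<close> where the chip moves. This function need not exist globally for a
  single move, because its total change along the edge, \<open>move_rise\<close> below, is nonzero for \<open>a < b\<close>.
\<close>

definition move_value :: "'v \<times> 'v \<times> real \<times> real \<Rightarrow> 'v \<Rightarrow> 'v \<Rightarrow> real \<Rightarrow> real" where
  "move_value = (\<lambda>(u, v, a, b) x y t.
     if x = u \<and> y = v then - ramp a b t
     else if x = v \<and> y = u then b - a - ramp a b (elen u v - t) else 0)"

text \<open>The slope of \<^const>\<open>move_value\<close> in a direction.\<close>

definition move_slope :: "'v \<times> 'v \<times> real \<times> real \<Rightarrow> 'v \<times> 'v \<times> real \<Rightarrow> int" where
  "move_slope = (\<lambda>(u, v, a, b) (x, y, t).
     if x = u \<and> y = v then (if a \<le> t \<and> t < b then - 1 else 0)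
     else if x = v \<and> y = u then (if a < elen u v - t \<and> elen u v - t \<le> b then 1 else 0) else 0)"

text \<open>The total change of \<^const>\<open>move_value\<close> from \<open>x\<close> to \<open>y\<close>.\<close>

definition move_rise :: "'v \<times> 'v \<times> real \<times> real \<Rightarrow> 'v \<Rightarrow> 'v \<Rightarrow> real" where
  "move_rise = (\<lambda>(u, v, a, b) x y.
     if x = u \<and> y = v then - (b - a) else if x = v \<and> y = u then b - a else 0)"

text \<open>The effect of a chip move on a divisor.\<close>

definition move_divisor :: "'v \<times> 'v \<times> real \<times> real \<Rightarrow> 'v divisor" where
  "move_divisor = (\<lambda>(u, v, a, b). Poly_Mapping.single (ep u v b) 1 - Poly_Mapping.single (ep u v a) 1)"

lemma right_slope_move: "chip_move c \<Longrightarrow> right_slope (move_value c x y) t (move_slope c (x, y, t))"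
  unfolding move_value_def move_slope_def chip_move_def
  using right_slope_const right_slope_ramp right_slope_ramp_reversed
  by (cases c) auto

lemma move_value_0: "chip_move c \<Longrightarrow> move_value c x y 0 = 0"
  by (cases c) (auto simp: move_value_def chip_move_def ramp_def)

lemma move_value_reverse:
  assumes "chip_move c" "adj x y"
  shows "move_value c y x t = move_value c x y (elen x y - t) - move_rise c x y"
proof -
  obtain u v a b where c: "c = (u, v, a, b)" by (cases c)
  have "u \<noteq> v" using assms(1) adj_neq by (auto simp: chip_move_def c)
  then show ?thesis using assms(1) elen_sym[of u v]
    by (auto simp: c move_value_def move_rise_def chip_move_def)
qed

text \<open>
  Although a single move need not come from a global function, its slopes at each point add up to the
  intended coefficient.
\<close>

lemma sum_move_slopes:
  assumes c: "chip_move c" and p: "p \<in> points G"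
  shows "(\<Sum>\<tau>\<in>directions G p. move_slope c \<tau>) = Poly_Mapping.lookup (move_divisor c) p"
proof -
  obtain u v a b where c_eq: "c = (u, v, a, b)" by (cases c)
  have uv: "adj u v" and ab: "0 \<le> a" "a \<le> b" "b \<le> elen u v"
    using c unfolding chip_move_def c_eq by auto
  have neq: "u \<noteq> v" by (rule adj_neq[OF uv])
  define N where "N = {\<tau> \<in> directions G p. move_slope c \<tau> \<noteq> 0}"
  have sum_N: "(\<Sum>\<tau>\<in>directions G p. move_slope c \<tau>) = (\<Sum>\<tau>\<in>N. move_slope c \<tau>)"
    by (rule sum.mono_neutral_right) (use finite_directions[OF p] in \<open>auto simp: N_def\<close>)
  show ?thesis
  proof (cases "\<exists>s. 0 \<le> s \<and> s \<le> elen u v \<and> p = ep u v s")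
    case False
    have "N = {}"
    proof (rule equals0I)
      fix \<tau> assume "\<tau> \<in> N"
      then obtain x y t where \<tau>: "adj x y" "0 \<le> t" "t < elen x y" "p = ep x y t" "move_slope c (x, y, t) \<noteq> 0"
        unfolding N_def by (cases \<tau>) (auto dest: directionsD)
      then consider "x = u" "y = v" | "x = v" "y = u"
        unfolding move_slope_def c_eq by (auto split: if_splits)
      then show False
      proof cases
        case 1
        then show False using False \<tau> less_imp_le by blast
      next
        case 2
        then have "p = ep u v (elen u v - t)" using \<tau> ep_swap[OF uv] by simp
        moreover have "t < elen u v" using \<tau>(3) 2 elen_sym[of u v] by simp
        ultimately show False using False \<tau>(2) by (metis diff_ge_0_iff_ge diff_le_eq le_add_same_cancel1 less_imp_le)
      qed
    qed
    moreover have "p \<noteq> ep u v a" "p \<noteq> ep u v b" using False ab by auto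
    ultimately show ?thesis
      unfolding sum_N by (simp add: c_eq move_divisor_def lookup_minus lookup_single when_def)
  next
    case True
    then obtain s where s: "0 \<le> s" "s \<le> elen u v" "p = ep u v s" by blast
    have dir1: "(u, v, t) \<in> directions G p \<longleftrightarrow> t = s \<and> s < elen u v" for t
      using uv s ep_inj[OF uv] by (auto simp: directions_def)
    have dir2: "(v, u, t) \<in> directions G p \<longleftrightarrow> t = elen u v - s \<and> 0 < s" for t
      using adj_sym[OF uv] s ep_inj[OF uv, of "elen u v - t" s] ep_swap[OF uv, of t] elen_sym[of v u]
      by (auto simp: directions_def)
    define W where "W = {(u, v, s), (v, u, elen u v - s)}"
    have N: "N \<subseteq> W"
    proof
      fix \<tau> assume "\<tau> \<in> N"
      then obtain x y t where \<tau>: "\<tau> = (x, y, t)" "(x, y, t) \<in> directions G p" "move_slope c (x, y, t) \<noteq> 0"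
        unfolding N_def by (cases \<tau>) auto
      then consider "x = u" "y = v" | "x = v" "y = u"
        unfolding move_slope_def c_eq by (auto split: if_splits)
      then show "\<tau> \<in> W" using \<tau> dir1 dir2 by cases (auto simp: W_def)
    qed
    have "(\<Sum>\<tau>\<in>N. move_slope c \<tau>) = (\<Sum>\<tau>\<in>W. move_slope c \<tau>)"
    proof (rule sum.mono_neutral_left)
      show "\<forall>\<tau>\<in>W - N. move_slope c \<tau> = 0"
      proof
        fix \<tau> assume \<tau>: "\<tau> \<in> W - N"
        then consider "\<tau> = (u, v, s)" | "\<tau> = (v, u, elen u v - s)" by (auto simp: W_def)
        then show "move_slope c \<tau> = 0"
        proof cases
          case 1
          then show ?thesis using \<tau> dir1[of s] ab neq s by (auto simp: N_def c_eq move_slope_def)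
        next
          case 2
          then show ?thesis using \<tau> dir2[of "elen u v - s"] ab neq s by (auto simp: N_def c_eq move_slope_def)
        qed
      qed
    qed (use N in \<open>auto simp: W_def\<close>)
    also have "\<dots> = (if a \<le> s \<and> s < b then - 1 else 0) + (if a < s \<and> s \<le> b then 1 else 0)"
      using neq by (simp add: W_def c_eq move_slope_def)
    also have "\<dots> = Poly_Mapping.lookup (move_divisor c) p"
      using ab ep_inj[OF uv] s(3) by (auto simp: c_eq move_divisor_def lookup_minus lookup_single when_def)
    finally show ?thesis using sum_N by simp
  qed
qed

text \<open>
  Simultaneous chip moves preserve the class of a divisor if there is a potential \<open>\<phi>\<close> on the vertices
  whose differences along the edges are the total changes caused by the moves. Then the functions of
  the single moves add up to a global one.
\<close>

theorem principal_chip_moves: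
  assumes C: "finite C" "\<And>c. c \<in> C \<Longrightarrow> chip_move c"
    and \<phi>: "\<And>x y. adj x y \<Longrightarrow> \<phi> y = \<phi> x + (\<Sum>c\<in>C. move_rise c x y)"
  shows "principal (\<Sum>c\<in>C. move_divisor c)"
proof -
  define F where "F x y t = \<phi> x + (\<Sum>c\<in>C. move_value c x y t)" for x y t
  have "\<exists>f. \<forall>x y t. adj x y \<and> 0 \<le> t \<and> t \<le> elen x y \<longrightarrow> f (ep x y t) = F x y t"
  proof (rule function_on_edges)
    show "F x y 0 = \<phi> x" if "adj x y" for x y
      using C(2) by (simp add: F_def move_value_0)
    show "F y x t = F x y (elen x y - t)" if "adj x y" for x y t
      using C(2) \<phi>[OF that] by (simp add: F_def move_value_reverse[OF _ that] sum_subtractf)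
  qed
  then obtain f where f: "\<And>x y t. adj x y \<Longrightarrow> 0 \<le> t \<Longrightarrow> t \<le> elen x y \<Longrightarrow> f (ep x y t) = F x y t"
    by blast
  have slope: "right_slope (\<lambda>s. f (ep x y s)) t (\<Sum>c\<in>C. move_slope c (x, y, t))"
    if xyt: "adj x y" "0 \<le> t" "t < elen x y" for x y t
  proof -
    have "right_slope (F x y) t (0 + (\<Sum>c\<in>C. move_slope c (x, y, t)))"
      unfolding F_def
      by (intro right_slope_add right_slope_const right_slope_sum right_slope_move C(2))
    then obtain e where e: "0 < e" "\<And>s. t \<le> s \<Longrightarrow> s \<le> t + e \<Longrightarrow>
        F x y s = F x y t + of_int (0 + (\<Sum>c\<in>C. move_slope c (x, y, t))) * (s - t)"
      by (rule right_slopeE) (rule that)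
    show ?thesis
    proof (rule right_slopeI)
      show "0 < min e (elen x y - t)" using e(1) xyt by simp
      show "f (ep x y s) = f (ep x y t) + of_int (\<Sum>c\<in>C. move_slope c (x, y, t)) * (s - t)"
        if "t \<le> s" "s \<le> t + min e (elen x y - t)" for s
        using e(2)[of s] f[of x y s] f[of x y t] xyt that by simp
    qed
  qed
  have "pl f" unfolding pl_def using slope by blast
  moreover have "is_div_of G (\<Sum>c\<in>C. move_divisor c) f"
    unfolding is_div_of_def
  proof (intro conjI ballI)
    show "(\<Sum>c\<in>C. move_divisor c) \<in> divisors G"
    proof (rule divisors_sum)
      fix c assume "c \<in> C"
      then show "move_divisor c \<in> divisors G"
        using C(2)[of c] unfolding chip_move_def move_divisor_def
        by (cases c) (auto intro!: divisors_diff divisors_single ep_points)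
    qed
    fix p assume p: "p \<in> points G"
    have "div_coeff G f p = (\<Sum>\<tau>\<in>directions G p. real_of_int (\<Sum>c\<in>C. move_slope c \<tau>))"
      unfolding div_coeff_def
      by (rule sum.cong) (auto dest!: directionsD intro!: outgoing_slope_eq slope simp del: of_int_sum)
    also have "\<dots> = of_int (\<Sum>c\<in>C. \<Sum>\<tau>\<in>directions G p. move_slope c \<tau>)"
      by (subst sum.swap) simp
    also have "\<dots> = of_int (Poly_Mapping.lookup (\<Sum>c\<in>C. move_divisor c) p)"
      using sum_move_slopes[OF C(2) p] by (simp add: lookup_sum_divisor)
    finally show "of_int (Poly_Mapping.lookup (\<Sum>c\<in>C. move_divisor c) p) = div_coeff G f p" by simp
  qed
  ultimately show ?thesis unfolding principal_def by blast
qed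

text \<open>
  Firing the complement of \<open>X\<close>: on every edge of the cut one chip moves the distance \<open>s\<close> towards \<open>X\<close>. The
  potential is \<open>- s\<close> on \<open>X\<close> and zero elsewhere.
\<close>

lemma principal_cut:
  assumes P: "P = {(u, x). adj u x \<and> u \<notin> X \<and> x \<in> X}"
    and s: "0 \<le> s" "\<And>u x. (u, x) \<in> P \<Longrightarrow> s \<le> elen u x"
  shows "principal (\<Sum>(u, x)\<in>P. Poly_Mapping.single (ep u x s) 1 - Poly_Mapping.single (vertex_point u) 1)"
proof -
  have finP: "finite P" by (rule finite_subset[OF _ finite_arcs]) (auto simp: P arcs_def)
  define g :: "'v \<times> 'v \<Rightarrow> 'v \<times> 'v \<times> real \<times> real" where "g = (\<lambda>(u, x). (u, x, 0, s))"
  have inj: "inj_on g P" by (auto simp: inj_on_def g_def)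
  define \<phi> where "\<phi> y = (if y \<in> X then - s else 0)" for y
  have "principal (\<Sum>c\<in>g ` P. move_divisor c)"
  proof (rule principal_chip_moves[where \<phi> = \<phi>])
    show "finite (g ` P)" using finP by simp
    show "chip_move c" if "c \<in> g ` P" for c
      using that s by (auto simp: g_def chip_move_def P)
    show "\<phi> y = \<phi> x + (\<Sum>c\<in>g ` P. move_rise c x y)" if xy: "adj x y" for x y
    proof -
      have "(\<Sum>c\<in>g ` P. move_rise c x y) = (\<Sum>e\<in>P. move_rise (g e) x y)"
        by (simp add: sum.reindex[OF inj])
      also have "\<dots> = (\<Sum>e\<in>P. (if e = (x, y) then - s else 0) + (if e = (y, x) then s else 0))"
        using adj_neq[OF xy] by (intro sum.cong) (auto simp: g_def move_rise_def split: if_splits)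
      also have "\<dots> = (if (x, y) \<in> P then - s else 0) + (if (y, x) \<in> P then s else 0)"
        using finP by (simp add: sum.distrib)
      finally show ?thesis using xy adj_sym[OF xy] by (auto simp: \<phi>_def P)
    qed
  qed
  also have "(\<Sum>c\<in>g ` P. move_divisor c) =
      (\<Sum>(u, x)\<in>P. Poly_Mapping.single (ep u x s) 1 - Poly_Mapping.single (vertex_point u) 1)"
    unfolding sum.reindex[OF inj] by (rule sum.cong) (auto simp: g_def move_divisor_def ep_0)
  finally show ?thesis .
qed

text \<open>
  Two chips on the same edge can approach each other. The two moves cancel in the total change along
  the edge, so that the potential is zero.
\<close>

lemma principal_segment:
  assumes uv: "adj u v" and "0 \<le> a" "b \<le> elen u v" "0 \<le> s" "a + s \<le> b - s"
  shows "principal ((Poly_Mapping.single (ep u v (a + s)) 1 + Poly_Mapping.single (ep u v (b - s)) 1) -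
                    (Poly_Mapping.single (ep u v a) 1 + Poly_Mapping.single (ep u v b) 1))"
proof -
  define C where "C = {(u, v, a, a + s), (v, u, elen u v - b, elen u v - b + s)}"
  have neq: "u \<noteq> v" by (rule adj_neq[OF uv])
  have "principal (\<Sum>c\<in>C. move_divisor c)"
  proof (rule principal_chip_moves[where \<phi> = "\<lambda>_. 0"])
    show "finite C" by (simp add: C_def)
    show "chip_move c" if "c \<in> C" for c
      using that assms adj_sym[OF uv] elen_sym[of v u] by (auto simp: C_def chip_move_def)
    show "(0::real) = 0 + (\<Sum>c\<in>C. move_rise c x y)" for x y
      using neq by (auto simp: C_def move_rise_def)
  qed
  also have "(\<Sum>c\<in>C. move_divisor c) =
      (Poly_Mapping.single (ep u v (a + s)) 1 + Poly_Mapping.single (ep u v (b - s)) 1) -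
      (Poly_Mapping.single (ep u v a) 1 + Poly_Mapping.single (ep u v b) 1)"
    using neq by (simp add: C_def move_divisor_def ep_swap[OF uv])
  finally show ?thesis .
qed

lemma linear_system_move:
  assumes "F \<in> linear_system G D" "principal (A - B)" "effective_divisor (F - B)" "effective_divisor A"
    "A \<in> divisors G" "B \<in> divisors G"
  shows "(F - B) + A \<in> linear_system G D"
proof -
  have "principal ((F - D) + (A - B))"
    using assms(1,2) by (intro principal_add) (simp_all add: linear_system_iff)
  moreover have "(F - D) + (A - B) = (F - B) + A - D" by simp
  ultimately show ?thesis
    using assms unfolding linear_system_iff by (simp add: effective_add divisors_add divisors_diff)
qed

end

section \<open>A divisor of rank one\<close>

lemma lookup_effective_add:
  assumes "effective_divisor E" "1 \<le> Poly_Mapping.lookup A p"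
  shows "1 \<le> Poly_Mapping.lookup (E + A) p"
proof -
  have "0 \<le> Poly_Mapping.lookup E p" using assms(1) by (simp add: effective_divisor_def)
  then show ?thesis using assms(2) by (simp add: lookup_add)
qed

context finite_metric_graph
begin

text \<open>Some effective divisor equivalent to \<open>D\<close> has a chip at \<open>p\<close>.\<close>

definition reachable :: "'v divisor \<Rightarrow> 'v point \<Rightarrow> bool" where
  "reachable D p \<longleftrightarrow> (\<exists>F\<in>linear_system G D. 1 \<le> Poly_Mapping.lookup F p)"

text \<open>
  Suppose that \<open>X\<close> is joined to its complement exactly by one edge from each \<open>r \<in> R\<close> to \<open>c \<in> X\<close>. Then one
  chip on each vertex of \<open>R\<close> suffices to reach the points of these edges. All chips move towards \<open>c\<close> until
  the one on the shortest edge, of length \<open>m\<close>, arrives. The points beyond \<open>m\<close> on a longer edge are reached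
  by moving the chip on this edge and the chip at \<open>c\<close> towards each other.
\<close>

lemma reachable_hub:
  assumes R: "R \<noteq> {}" "R \<subseteq> verts G"
    and X: "{(u, x). adj u x \<and> u \<notin> X \<and> x \<in> X} = R \<times> {c}"
    and r: "r \<in> R" and t: "0 \<le> t" "t \<le> elen r c"
  defines "D \<equiv> (\<Sum>r\<in>R. Poly_Mapping.single (vertex_point r) 1)"
  shows "reachable D (ep r c t)"
proof -
  have fin: "finite R" using R(2) finite_verts finite_subset by blast
  have adjR: "adj r c" if "r \<in> R" for r using X that by auto
  define m where "m = Min ((\<lambda>r. elen r c) ` R)"
  have m_le: "m \<le> elen r c" if "r \<in> R" for r using fin that by (simp add: m_def)
  have "m \<in> (\<lambda>r. elen r c) ` R" unfolding m_def by (rule Min_in) (use fin R(1) in auto)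
  then obtain r0 where r0: "r0 \<in> R" "m = elen r0 c" by blast
  have m_pos: "0 < m" using r0 elen_pos[OF adjR] by simp
  define E where "E s = (\<Sum>r\<in>R. Poly_Mapping.single (ep r c s) (1::int))" for s
  have single_div: "Poly_Mapping.single (ep r c s) n \<in> divisors G" if "r \<in> R" "0 \<le> s" "s \<le> elen r c" for r s and n :: int
    using that by (intro divisors_single ep_points adjR)
  have E: "E s \<in> linear_system G D" if s: "0 \<le> s" "s \<le> m" for s
  proof -
    have "principal (\<Sum>(u, x)\<in>R \<times> {c}. Poly_Mapping.single (ep u x s) 1 - Poly_Mapping.single (vertex_point u) 1)"
      by (rule principal_cut[where X = X]) (use X s m_le in \<open>auto intro: order_trans\<close>)
    also have "(\<Sum>(u, x)\<in>R \<times> {c}. Poly_Mapping.single (ep u x s) (1::int) - Poly_Mapping.single (vertex_point u) 1) = E s - D"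
      by (simp add: sum.cartesian_product[symmetric] E_def D_def sum_subtractf)
    finally have "principal (E s - D)" .
    moreover have "E s \<in> divisors G"
      unfolding E_def using s m_le by (intro divisors_sum single_div) (auto intro: order_trans)
    moreover have "effective_divisor (E s)"
      unfolding E_def by (intro effective_sum effective_single) simp
    ultimately show ?thesis by (simp add: linear_system_iff)
  qed
  show ?thesis
  proof (cases "t \<le> m")
    case True
    have "E t = Poly_Mapping.single (ep r c t) 1 + (\<Sum>r\<in>R - {r}. Poly_Mapping.single (ep r c t) 1)"
      unfolding E_def by (rule sum.remove[OF fin r])
    moreover have "effective_divisor (\<Sum>r\<in>R - {r}. Poly_Mapping.single (ep r c t) (1::int))"
      by (intro effective_sum effective_single) simp
    ultimately have "1 \<le> Poly_Mapping.lookup (E t) (ep r c t)"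
      by (simp add: effective_divisor_def lookup_add)
    then show ?thesis using E[OF t(1) True] unfolding reachable_def by blast
  next
    case False
    then have "r \<noteq> r0" using r0 t by auto
    \<comment> \<open>the distance from the target to the nearer one of the two chips\<close>
    define s where "s = min (t - m) (elen r c - t)"
    define B where "B = Poly_Mapping.single (ep r c m) (1::int) + Poly_Mapping.single (ep r c (elen r c)) 1"
    define A where "A = Poly_Mapping.single (ep r c (m + s)) (1::int) + Poly_Mapping.single (ep r c (elen r c - s)) 1"
    have s: "0 \<le> s" "m + s \<le> elen r c - s" "t = m + s \<or> t = elen r c - s"
      using False t unfolding s_def by (auto simp: min_def)
    have pr: "principal (A - B)"
      unfolding A_def B_def using s m_pos by (intro principal_segment adjR r) auto
    have "E m = Poly_Mapping.single (ep r c m) 1 + (\<Sum>r\<in>R - {r}. Poly_Mapping.single (ep r c m) 1)"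
      unfolding E_def by (rule sum.remove[OF fin r])
    also have "(\<Sum>r\<in>R - {r}. Poly_Mapping.single (ep r c m) (1::int)) =
        Poly_Mapping.single (ep r0 c m) 1 + (\<Sum>r\<in>R - {r} - {r0}. Poly_Mapping.single (ep r c m) 1)"
      using fin r0 \<open>r \<noteq> r0\<close> by (intro sum.remove) auto
    also have "ep r0 c m = ep r c (elen r c)"
      using r0 r ep_elen[OF adjR] by simp
    finally have "E m - B = (\<Sum>r\<in>R - {r} - {r0}. Poly_Mapping.single (ep r c m) 1)"
      by (simp add: B_def)
    moreover have "effective_divisor (\<Sum>r\<in>R - {r} - {r0}. Poly_Mapping.single (ep r c m) (1::int))"
      by (intro effective_sum effective_single) simp
    ultimately have eff: "effective_divisor (E m - B)" by simp
    have "(E m - B) + A \<in> linear_system G D"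
    proof (rule linear_system_move[OF E pr eff])
      show "effective_divisor A" unfolding A_def by (intro effective_add effective_single) simp_all
      show "A \<in> divisors G" "B \<in> divisors G"
        unfolding A_def B_def using s m_pos r by (auto intro!: divisors_add single_div)
    qed (use m_pos in auto)
    moreover have "1 \<le> Poly_Mapping.lookup A (ep r c t)"
      unfolding A_def using s(3) by (auto simp: lookup_add lookup_single when_def)
    then have "1 \<le> Poly_Mapping.lookup ((E m - B) + A) (ep r c t)"
      by (rule lookup_effective_add[OF eff])
    ultimately show ?thesis unfolding reachable_def by blast
  qed
qed

text \<open>A chip moves freely along the edge to a leaf \<open>v\<close>, by firing the complement of \<open>v\<close>.\<close>

lemma reachable_leaf:
  assumes leaf: "\<And>u. adj u v \<longleftrightarrow> u = w" and t: "0 \<le> t" "t \<le> elen w v"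
    and w: "reachable D (vertex_point w)"
  shows "reachable D (ep w v t)"
proof -
  have wv: "adj w v" using leaf by blast
  let ?A = "Poly_Mapping.single (ep w v t) (1::int)" and ?B = "Poly_Mapping.single (vertex_point w) (1::int)"
  have "w \<noteq> v" by (rule adj_neq[OF wv])
  then have "{(u, x). adj u x \<and> u \<notin> {v} \<and> x \<in> {v}} = {(w, v)}" using leaf by auto
  then have pr: "principal (?A - ?B)"
    using principal_cut[of "{(w, v)}" "{v}" t] t by simp
  obtain F where F: "F \<in> linear_system G D" "1 \<le> Poly_Mapping.lookup F (vertex_point w)"
    using w unfolding reachable_def by blast
  have eff: "effective_divisor (F - ?B)"
    using F by (intro effective_minus_single) (simp_all add: linear_system_iff)
  have "(F - ?B) + ?A \<in> linear_system G D"
    using wv t adj_verts[OF wv]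
    by (intro linear_system_move[OF F(1) pr eff] effective_single divisors_single ep_points vertex_points) auto
  moreover have "1 \<le> Poly_Mapping.lookup ((F - ?B) + ?A) (ep w v t)"
    using eff by (simp add: effective_divisor_def lookup_add)
  ultimately show ?thesis unfolding reachable_def by blast
qed

lemma reachable_within:
  assumes R: "R \<subseteq> verts G" "x \<in> R" "y \<in> R" and xy: "adj x y" and t: "0 \<le> t" "t \<le> elen x y"
  defines "D \<equiv> (\<Sum>r\<in>R. Poly_Mapping.single (vertex_point r) 1)"
  shows "reachable D (ep x y t)"
proof -
  have fin: "finite R" using R(1) finite_verts finite_subset by blast
  have D: "D \<in> linear_system G D"
    unfolding linear_system_iff D_def using R principal_zero
    by (auto intro!: divisors_sum divisors_single vertex_points effective_sum effective_single)
  define s where "s = min t (elen x y - t)"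
  define B where "B = Poly_Mapping.single (ep x y 0) (1::int) + Poly_Mapping.single (ep x y (elen x y)) 1"
  define A where "A = Poly_Mapping.single (ep x y (0 + s)) (1::int) + Poly_Mapping.single (ep x y (elen x y - s)) 1"
  have s: "0 \<le> s" "0 + s \<le> elen x y - s" "t = s \<or> t = elen x y - s"
    using t unfolding s_def by (auto simp: min_def)
  have pr: "principal (A - B)"
    unfolding A_def B_def using s by (intro principal_segment xy) auto
  have "D = Poly_Mapping.single (vertex_point x) 1 + (\<Sum>r\<in>R - {x}. Poly_Mapping.single (vertex_point r) 1)"
    unfolding D_def by (rule sum.remove[OF fin R(2)])
  also have "(\<Sum>r\<in>R - {x}. Poly_Mapping.single (vertex_point r) (1::int)) =
      Poly_Mapping.single (vertex_point y) 1 + (\<Sum>r\<in>R - {x} - {y}. Poly_Mapping.single (vertex_point r) 1)"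
    using fin R adj_neq[OF xy] by (intro sum.remove) auto
  finally have "D - B = (\<Sum>r\<in>R - {x} - {y}. Poly_Mapping.single (vertex_point r) 1)"
    by (simp add: B_def ep_0 ep_elen[OF xy])
  moreover have "effective_divisor (\<Sum>r\<in>R - {x} - {y}. Poly_Mapping.single (vertex_point r) (1::int))"
    by (intro effective_sum effective_single) simp
  ultimately have eff: "effective_divisor (D - B)" by simp
  have "(D - B) + A \<in> linear_system G D"
  proof (rule linear_system_move[OF D pr eff])
    show "effective_divisor A" unfolding A_def by (intro effective_add effective_single) simp_all
    show "A \<in> divisors G" "B \<in> divisors G"
      unfolding A_def B_def using s xy elen_pos[OF xy] by (auto intro!: divisors_add divisors_single ep_points)
  qed
  moreover have "1 \<le> Poly_Mapping.lookup A (ep x y t)"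
    unfolding A_def using s(3) by (auto simp: lookup_add lookup_single when_def)
  then have "1 \<le> Poly_Mapping.lookup ((D - B) + A) (ep x y t)"
    by (rule lookup_effective_add[OF eff])
  ultimately show ?thesis unfolding reachable_def by blast
qed

end

text \<open>
  A clique \<open>R\<close>, two further vertices \<open>w\<close> and \<open>b\<close> joined to all of \<open>R\<close> but not to each other, and a leaf \<open>v\<close>
  attached to \<open>w\<close>.
\<close>

locale clique_with_hubs = finite_metric_graph G for G :: "'v metric_graph" +
  fixes R :: "'v set" and w b v :: 'v
  assumes R_ne: "R \<noteq> {}"
    and fresh: "w \<notin> R" "b \<notin> R" "v \<notin> R" "w \<noteq> b" "w \<noteq> v" "b \<noteq> v"
    and verts_eq: "verts G = R \<union> {w, b, v}"
    and adj_cases: "adj x y \<longleftrightarrow> (x \<in> R \<and> y \<in> R \<and> x \<noteq> y) \<or> (x \<in> R \<and> y = w) \<or> (x = w \<and> y \<in> R) \<or>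
      (x \<in> R \<and> y = b) \<or> (x = b \<and> y \<in> R) \<or> (x = w \<and> y = v) \<or> (x = v \<and> y = w)"
begin

text \<open>All edges meet the star formed by the edges at a vertex of \<open>R\<close>.\<close>

lemma connected_points: "connected (points G)"
proof -
  obtain r where r: "r \<in> R" using R_ne by blast
  define T where "T = (\<Union>x\<in>R \<union> {w, b} - {r}. segment r x)"
  have adj_r: "adj r x" if "x \<in> R \<union> {w, b} - {r}" for x
    using that r unfolding adj_cases by blast
  have r_seg: "vertex_point r \<in> segment r x" if "x \<in> R \<union> {w, b} - {r}" for x
    unfolding segment_def using elen_pos[OF adj_r[OF that]] by (intro image_eqI[of _ _ 0]) (auto simp: ep_0)
  have wT: "w \<in> R \<union> {w, b} - {r}" using r fresh by auto
  have conT: "connected T"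
    unfolding T_def
  proof (rule connected_Union)
    show "connected s" if "s \<in> segment r ` (R \<union> {w, b} - {r})" for s using that connected_segment by auto
    show "\<Inter> (segment r ` (R \<union> {w, b} - {r})) \<noteq> {}" using r_seg by blast
  qed
  have vT: "vertex_point x \<in> T" if "x \<in> R \<union> {w, b}" for x
  proof (cases "x = r")
    case True
    then show ?thesis using r_seg[OF wT] wT unfolding T_def by blast
  next
    case False
    then have x: "x \<in> R \<union> {w, b} - {r}" using that by blast
    have "vertex_point x \<in> segment r x"
      unfolding segment_def using elen_pos[OF adj_r[OF x]] ep_elen[OF adj_r[OF x]]
      by (intro image_eqI[of _ _ "elen r x"]) auto
    then show ?thesis using x unfolding T_def by blast
  qed
  have "connected (\<Union>e\<in>arcs. T \<union> segment (fst e) (snd e))"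
  proof (rule connected_Union)
    have "vertex_point r \<in> T" using vT r by blast
    then show "\<Inter> ((\<lambda>e. T \<union> segment (fst e) (snd e)) ` arcs) \<noteq> {}" by blast
    fix S assume "S \<in> (\<lambda>e. T \<union> segment (fst e) (snd e)) ` arcs"
    then obtain x y where xy: "adj x y" "S = T \<union> segment x y" by (auto simp: arcs_def)
    have ends: "vertex_point x \<in> segment x y" "vertex_point y \<in> segment x y"
      unfolding segment_def using elen_pos[OF xy(1)] ep_elen[OF xy(1)] ep_0[of x y]
      by (simp_all add: image_eqI[of _ _ 0] image_eqI[of _ _ "elen x y"])
    have "x \<in> R \<union> {w, b} \<or> y \<in> R \<union> {w, b}" using xy(1) unfolding adj_cases by blast
    then have "T \<inter> segment x y \<noteq> {}" using ends vT by blast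
    then show "connected S" unfolding xy(2) by (intro connected_Un conT connected_segment)
  qed
  moreover have "(\<Union>e\<in>arcs. T \<union> segment (fst e) (snd e)) = points G"
  proof -
    have "(r, w) \<in> arcs" using adj_r[OF wT] by (simp add: arcs_def)
    moreover have "T \<subseteq> points G"
      unfolding T_def points_segments using adj_r by (fastforce simp: arcs_def)
    ultimately show ?thesis unfolding points_segments by fastforce
  qed
  ultimately show ?thesis by simp
qed

text \<open>
  One chip on each vertex of \<open>R\<close> has rank one, and \<open>insert w R\<close> is a clique with one vertex more.
\<close>

theorem gonality_eq: "gonality G = int (card R)"
proof -
  have finR: "finite R" using finite_verts verts_eq by simp
  define D where "D = (\<Sum>r\<in>R. Poly_Mapping.single (vertex_point r :: 'v point) (1::int))"
  have "adj u x \<and> u \<notin> {w, v} \<and> x \<in> {w, v} \<longleftrightarrow> u \<in> R \<and> x = w" for u x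
    unfolding adj_cases using fresh by blast
  then have cw: "{(u, x). adj u x \<and> u \<notin> {w, v} \<and> x \<in> {w, v}} = R \<times> {w}" by blast
  have "adj u x \<and> u \<notin> {b} \<and> x \<in> {b} \<longleftrightarrow> u \<in> R \<and> x = b" for u x
    unfolding adj_cases using fresh by blast
  then have cb: "{(u, x). adj u x \<and> u \<notin> {b} \<and> x \<in> {b}} = R \<times> {b}" by blast
  have RV: "R \<subseteq> verts G" using verts_eq by blast
  have leaf: "adj u v \<longleftrightarrow> u = w" for u unfolding adj_cases using fresh by blast
  have hub_w: "reachable D (ep r w t)" if "r \<in> R" "0 \<le> t" "t \<le> elen r w" for r t
    unfolding D_def by (rule reachable_hub[OF R_ne RV cw that])
  have hub_b: "reachable D (ep r b t)" if "r \<in> R" "0 \<le> t" "t \<le> elen r b" for r t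
    unfolding D_def by (rule reachable_hub[OF R_ne RV cb that])
  obtain r where r: "r \<in> R" using R_ne by blast
  then have rw: "adj r w" unfolding adj_cases by blast
  have "reachable D (vertex_point w)"
    using hub_w[OF r, of "elen r w"] elen_pos[OF rw] ep_elen[OF rw] by simp
  then have on_leaf: "reachable D (ep w v t)" if "0 \<le> t" "t \<le> elen w v" for t
    by (intro reachable_leaf[OF leaf that])
  have "reachable D p" if p: "p \<in> points G" for p
  proof -
    obtain x y t where xy: "adj x y" "0 \<le> t" "t < elen x y" "p = ep x y t" using points_arc[OF p] by blast
    have rev: "p = ep y x (elen y x - t)" "0 \<le> elen y x - t" "elen y x - t \<le> elen y x"
      using xy ep_swap[OF adj_sym[OF xy(1)], of t] elen_sym[of x y] by auto
    consider "x \<in> R" "y \<in> R" | "x \<in> R" "y = w" | "x = w" "y \<in> R" | "x \<in> R" "y = b" | "x = b" "y \<in> R"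
      | "x = w" "y = v" | "x = v" "y = w"
      using xy(1) unfolding adj_cases by blast
    then show ?thesis
    proof cases
      case 1
      then show ?thesis using reachable_within[OF RV 1 xy(1)] xy unfolding D_def by simp
    next
      case 2
      then show ?thesis using hub_w xy by simp
    next
      case 3
      then show ?thesis using hub_w[of y] rev by simp
    next
      case 4
      then show ?thesis using hub_b xy by simp
    next
      case 5
      then show ?thesis using hub_b[of y] rev by simp
    next
      case 6
      then show ?thesis using on_leaf xy by simp
    next
      case 7
      then show ?thesis using on_leaf rev by simp
    qed
  qed
  then have "rank_ge D 1" unfolding rank_ge_one_iff reachable_def by blast
  moreover have "D \<in> divisors G"
    unfolding D_def using RV by (auto intro!: divisors_sum divisors_single vertex_points)
  moreover have "divisor_degree D = int (card R)"
    unfolding D_def by (simp add: degree_sum degree_single)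
  ultimately have "gonality G = int (card (insert w R)) - 1"
    using verts_eq finR fresh by (intro gonality_clique[where D = D]) (auto simp: adj_cases)
  then show ?thesis using finR fresh by simp
qed

end

section \<open>The choice of the omitted edges\<close>

theorem theorem22:
  fixes K :: "'v metric_graph" and d :: nat
  assumes "4 \<le> d"
    and "complete_metric_graph d K"
  shows "\<exists>S. S \<subseteq> edges K \<and> card S = d - 1 \<and> \<not> contains_K3 K S \<and>
             connected (points (omit_edges K S)) \<and>
             gonality (omit_edges K S) = int d - 3"
proof -
  have K: "finite (verts K)" "card (verts K) = d"
      "edges K = {e. e \<subseteq> verts K \<and> card e = 2}" "\<And>e. e \<in> edges K \<Longrightarrow> 0 < len K e"
    using assms(2) unfolding complete_metric_graph_def by blast+
  have "3 \<le> card (verts K)" using assms(1) K(2) by simp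
  then obtain W where W: "W \<subseteq> verts K" "card W = 3" by (rule obtain_subset_with_card_n)
  then obtain w b v where wbv: "W = {w, b, v}" "w \<noteq> b" "w \<noteq> v" "b \<noteq> v" unfolding card_3_iff by blast
  define R where "R = verts K - {w, b, v}"
  have fresh: "w \<notin> R" "b \<notin> R" "v \<notin> R" by (auto simp: R_def)
  have verts_eq: "verts K = R \<union> {w, b, v}" using W wbv by (auto simp: R_def)
  have finR: "finite R" using K(1) by (simp add: R_def)
  have cardR: "card R = d - 3"
    using W wbv K(1,2) card_Diff_subset[of W "verts K"] finite_subset[OF W(1)] by (simp add: R_def)
  have K_adj: "{x, y} \<in> edges K \<longleftrightarrow> x \<noteq> y \<and> x \<in> verts K \<and> y \<in> verts K" for x y
    unfolding K(3) by (cases "x = y") auto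
  \<comment> \<open>the edge \<open>wb\<close>, and all edges at \<open>v\<close> except \<open>vw\<close>\<close>
  define S where "S = insert {w, b} ((\<lambda>x. {v, x}) ` insert b R)"
  have S_iff: "{x, y} \<in> S \<longleftrightarrow> (x = w \<and> y = b) \<or> (x = b \<and> y = w) \<or>
      (x = v \<and> (y = b \<or> y \<in> R)) \<or> (y = v \<and> (x = b \<or> x \<in> R))" for x y
    unfolding S_def insert_iff image_iff bex_simps doubleton_eq_iff by blast
  have S_sub: "S \<subseteq> edges K"
  proof
    fix e assume "e \<in> S"
    then consider "e = {w, b}" | x where "e = {v, x}" "x = b \<or> x \<in> R" unfolding S_def by blast
    then show "e \<in> edges K"
    proof cases
      case 1
      then show ?thesis using wbv verts_eq by (simp add: K_adj)
    next
      case 2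
      then show ?thesis using wbv(4) fresh(3) verts_eq by (auto simp: K_adj)
    qed
  qed
  have cardS: "card S = d - 1"
  proof -
    let ?T = "(\<lambda>x. {v, x}) ` insert b R"
    have "inj_on (\<lambda>x. {v, x}) (insert b R)"
    proof (rule inj_onI)
      fix x y assume "{v, x} = {v, y}"
      then show "x = y" unfolding doubleton_eq_iff by blast
    qed
    then have "card ?T = card (insert b R)" by (rule card_image)
    also have "\<dots> = d - 2" using finR fresh(2) cardR assms(1) by simp
    finally have cardT: "card ?T = d - 2" .
    have wb: "{w, b} \<notin> ?T"
    proof
      assume "{w, b} \<in> ?T"
      then obtain x where "{w, b} = {v, x}" by blast
      then show False using wbv(3,4) unfolding doubleton_eq_iff by blast
    qed
    have "finite ?T" using finR by blast
    from card_insert_disjoint[OF this wb] have "card (insert {w, b} ?T) = Suc (d - 2)"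
      unfolding cardT .
    then show ?thesis using assms(1) unfolding S_def by linarith
  qed
  have no_K3: "\<not> contains_K3 K S"
  proof
    assume "contains_K3 K S"
    then obtain x y z where neq: "x \<noteq> y" "y \<noteq> z" "x \<noteq> z"
      and e: "{x, y} \<in> S" "{y, z} \<in> S" "{x, z} \<in> S"
      unfolding contains_K3_def by (elim bexE conjE)
    have wb: "p = w \<and> q = b \<or> p = b \<and> q = w" if "{p, q} \<in> S" "p \<noteq> v" "q \<noteq> v" for p q
      using that S_iff[of p q] by simp
    have not_w: "q \<noteq> w" if "{p, q} \<in> S" "p = v" for p q
      using that S_iff[of p q] wbv(2-4) fresh(1) by auto
    have not_w': "p \<noteq> w" if "{p, q} \<in> S" "q = v" for p q
      using that S_iff[of p q] wbv(2-4) fresh(1) by auto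
    consider "x = v" | "y = v" | "z = v" | "x \<noteq> v" "y \<noteq> v" "z \<noteq> v" by blast
    then show False
    proof cases
      case 1
      then show ?thesis using not_w[OF e(1)] not_w[OF e(3)] wb[OF e(2)] neq by auto
    next
      case 2
      then show ?thesis using not_w'[OF e(1)] not_w[OF e(2)] wb[OF e(3)] neq by auto
    next
      case 3
      then show ?thesis using not_w'[OF e(2)] not_w'[OF e(3)] wb[OF e(1)] neq by auto
    next
      case 4
      then show ?thesis using wb[OF e(1)] wb[OF e(2)] wb[OF e(3)] neq by auto
    qed
  qed
  let ?G = "omit_edges K S"
  have edges_G: "edges ?G = edges K - S" and verts_G: "verts ?G = verts K" and len_G: "len ?G = len K"
    by (simp_all add: omit_edges_def)
  have adj: "{x, y} \<in> edges ?G \<longleftrightarrow> (x \<in> R \<and> y \<in> R \<and> x \<noteq> y) \<or> (x \<in> R \<and> y = w) \<or> (x = w \<and> y \<in> R) \<or>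
      (x \<in> R \<and> y = b) \<or> (x = b \<and> y \<in> R) \<or> (x = w \<and> y = v) \<or> (x = v \<and> y = w)" for x y
    unfolding edges_G Diff_iff K_adj S_iff verts_eq using wbv fresh by blast
  have R_ne: "R \<noteq> {}" using cardR assms(1) by auto
  then obtain r where r: "r \<in> R" by blast
  have Un: "\<Union> (edges ?G) = verts ?G"
  proof
    show "\<Union> (edges ?G) \<subseteq> verts ?G" unfolding edges_G verts_G K(3) by blast
    have "{r, w} \<in> edges ?G" "{r, b} \<in> edges ?G" "{w, v} \<in> edges ?G"
      using r unfolding adj by blast+
    moreover have "{w, x} \<in> edges ?G" if "x \<in> R" for x
      using that unfolding adj by blast
    ultimately show "verts ?G \<subseteq> \<Union> (edges ?G)" unfolding verts_G verts_eq by blast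
  qed
  interpret clique_with_hubs ?G R w b v
  proof unfold_locales
    show "finite (verts ?G)" "verts ?G = R \<union> {w, b, v}"
      unfolding verts_G using K(1) verts_eq by simp_all
    show "card e = 2" "0 < len ?G e" if "e \<in> edges ?G" for e
      using that K(3,4) unfolding edges_G len_G by blast+
  qed (use R_ne fresh wbv adj Un in simp_all)
  show ?thesis
    using S_sub cardS no_K3 connected_points gonality_eq cardR assms(1)
    by (intro exI[of _ S]) (simp add: of_nat_diff)
qed

end
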